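(* Consider the rotation of a rigid body around a fixed point in a Newton field with a homogeneous quadratic potential, with spectral curve $\Gamma$ and involution $\sigma$ as in the context, and let the components of the angular velocity be given by $$\omega_i^j(t)=A_i^j\exp(t\xi_i^j)\frac{\theta(tU+z_i^j|\Omega)}{\theta(tU+z_0|\Omega)},$$ where $A_i^j,\xi_i^j$ are constants, $z_i^j,z_0\in J(\Gamma)$ (lifted to $\mathbb{C}^4$), and $U=(U_1,U_2,U_3,U_1)$ is a vector tangent to the Prym variety $Pr(\Gamma)$. Then the components of the angular velocity are expressed in terms of the Prym theta functions by the formula $$\omega_i^j(t)=A_i^j\exp(t\xi_i^j)\,\frac{c_0\,\theta(t\widetilde U+\tilde z_i^j|\Pi)+c_1\,\theta[\Delta^{-1}\varepsilon_1,0](t\widetilde U+\tilde z_i^j|\Pi)}{c_0'\,\theta(t\widetilde U+\tilde z|\Pi)+c_1'\,\theta[\Delta^{-1}\varepsilon_1,0](t\widetilde U+\tilde z|\Pi)},$$ where $\varepsilon_1=(1,0,0)$, $\Delta=\mathrm{diag}(2,1,1)$, $\widetilde U=(2U_1,U_2,U_3)$; for $w=(w_1,w_2,w_3,\tilde w_1)\in\mathbb{C}^4$ one writes $\tilde w=(w_1+\tilde w_1,w_2,w_3)\in\mathbb{C}^3$, so that $\tilde z_i^j$ is obtained from $z_i^j$ and $\tilde z$ from $z_0$; and the constants are $c_0=c_{(0,0,0)}(-z_i^j)$, $c_1=c_{(1,0,0)}(-z_i^j)$, $c_0'=c_{(0,0,0)}(-z_0)$, $c_1'=c_{(1,0,0)}(-z_0)$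 with, for $\gamma\in\mathbb{C}^4$ and $\varepsilon=(\varepsilon^{(1)},0,0)$, $\varepsilon^{(1)}\in\{0,1\}$, $$c_\varepsilon(\gamma)=\sum_{m\in\mathbb{Z}}\exp\bigl(\pi i\langle m_\varepsilon,\Omega m_\varepsilon\rangle+\pi i\langle\varepsilon,\tilde\gamma\rangle-2\pi i\langle m_\varepsilon,\gamma\rangle-\pi i\langle\Delta^{-1}\varepsilon,\Pi\Delta^{-1}\varepsilon\rangle\bigr),\qquad m_\varepsilon=(m,0,0,\varepsilon^{(1)}-m).$$
   Context: Mechanical setting. The rotation of a rigid body $S$ around a fixed point, in a coordinate system rotating with $S$, in the Newton field with potential $\varphi$, is described by the generalized Euler equations $\dot M=M\times\omega+\frac{\partial U}{\partial\alpha}\times\alpha+\frac{\partial U}{\partial\beta}\times\beta+\frac{\partial U}{\partial\gamma}\times\gamma$, $\dot\alpha=\alpha\times\omega$, $\dot\beta=\beta\times\omega$, $\dot\gamma=\gamma\times\omega$, where $(\alpha,\beta,\gamma)$ is the orthonormal basis of the fixed coordinate system, here $U(\alpha,\beta,\gamma)=\int_S\rho(r)\varphi(\langle r,\alpha\rangle,\langle r,\beta\rangle,\langle r,\gamma\rangle)\,dr_1dr_2dr_3$ with $\rho$ the density ($U$, $\gamma$, $\varphi$ in this sentence are unrelated to the symbols in the claim), $M_i=\sum_kI_{ik}\omega_k$ and $I$ is the inertia tensor. Identifying vectors in $\mathbb{R}^3$ with skew-symmetric $3\times3$ matrices, for a quadratic potential these yield the Lax equation $[L,\partial_t+Q]=0$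 with $L=BE^2+ME+u$, $Q=\omega-EI$, where $u$, $B$ are symmetric matrices and $E$ is a parameter; $\omega_i^j$ are the entries of the skew-symmetric matrix $\omega$. $\Gamma$ is the smooth completion of the curve $\det(BE^2+ME+u-w\cdot 1)=0$ in $\mathbb{C}^2$, with involution $\sigma(w,E)=(w,-E)$; $\Gamma$ has genus $4$, $\Gamma/\sigma$ is elliptic, and $\sigma$ has $6$ fixed points. The formula for $\omega_i^j(t)$ through the theta function of the Jacobi variety of $\Gamma$ given as the starting point in the claim is a known result of Bogoyavlenskij, who determines the constants $A_i^j,\xi_i^j$ and vectors $z_i^j,z_0,U$. Theta functions. $\langle x,y\rangle=\sum_jx_jy_j$; $\theta[a,b](z|\Omega)=\sum_{l\in\mathbb{Z}^k}\exp(\pi i\langle l+a,\Omega(l+a)\rangle+2\pi i\langle l+a,z+b\rangle)$ and $\theta(z|\Omega)=\theta[0,0](z|\Omega)$, for $\Omega$ symmetric $k\times k$ with positive definite imaginary part. Period matrices. Fix a canonical basis of cycles $a_1,a_2,a_3,\tilde a_1,b_1,b_2,b_3,\tilde b_1$ on $\Gamma$ with, in homology, $\sigma(a_1)+\tilde a_1=\sigma(b_1)+\tilde b_1=0$ and $\sigma(a_j)+a_j=\sigma(b_j)+b_j=0$ for $j=2,3$, with dual normalized holomorphic differentials $u_1,u_2,u_3,\tilde u_1$ (so $\sigma^*u_1=-\tilde u_1$, $\sigma^*u_j=-u_j$). $\Omega$ is the $4\times4$ matrix of $b$-periods and $J(\Gamma)=\mathbb{C}^4/\{\mathbb{Z}^4+\Omega\mathbb{Z}^4\}$.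 The Prym variety is $Pr(\Gamma)=\{z\in J(\Gamma)\mid\sigma_*(z)=-z\}$, where $\sigma_*(z_1,z_2,z_3,\tilde z_1)=-(\tilde z_1,z_2,z_3,z_1)$. With $\omega_1'=u_1+\tilde u_1$, $\omega_2'=u_2$, $\omega_3'=u_3$, $\Pi$ is the symmetric $3\times3$ matrix (positive definite imaginary part) with $\Pi_{1k}=2\int_{b_1}\omega_k'$, $\Pi_{jk}=\int_{b_j}\omega_k'$ ($j=2,3$, $1\le k\le3$). The Prym theta functions are spanned by $\theta(\cdot|\Pi)$ and $\theta[\Delta^{-1}\varepsilon_1,0](\cdot|\Pi)$. *)

theory Defs
  imports "HOL-Homology.Homology" "HOL-Analysis.Analysis"
begin

section \<open>Rotation of a rigid body in a quadratic potential\<close>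

definition rigid_body :: "(real^3) set \<Rightarrow> (real^3 \<Rightarrow> real) \<Rightarrow> bool" where
  "rigid_body S \<rho> \<longleftrightarrow> S \<in> sets lebesgue \<and> bounded S \<and> (\<forall>r\<in>S. 0 \<le> \<rho> r) \<and>
     set_integrable lebesgue S \<rho> \<and> 0 < (LINT r:S|lebesgue. \<rho> r)"

definition inertia_tensor :: "(real^3) set \<Rightarrow> (real^3 \<Rightarrow> real) \<Rightarrow> real^3^3" where
  "inertia_tensor S \<rho> =
     (\<chi> i k. LINT r:S|lebesgue. \<rho> r * ((if i = k then r \<bullet> r else 0) - r$i * r$k))"

definition homogeneous_quadratic :: "(real^3 \<Rightarrow> real) \<Rightarrow> bool" where
  "homogeneous_quadratic \<phi> \<longleftrightarrow> (\<exists>q::real^3^3. transpose q = q \<and> (\<forall>x. \<phi> x = x \<bullet> (q *v x)))"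

definition body_potential ::
  "(real^3) set \<Rightarrow> (real^3 \<Rightarrow> real) \<Rightarrow> (real^3 \<Rightarrow> real) \<Rightarrow> real^3 \<Rightarrow> real^3 \<Rightarrow> real^3 \<Rightarrow> real" where
  "body_potential S \<rho> \<phi> \<alpha> \<beta> \<gamma> =
     (LINT r:S|lebesgue. \<rho> r * \<phi> (vector [r \<bullet> \<alpha>, r \<bullet> \<beta>, r \<bullet> \<gamma>]))"

definition grad :: "(real^3 \<Rightarrow> real) \<Rightarrow> real^3 \<Rightarrow> real^3" where
  "grad f x = (\<chi> i. frechet_derivative f (at x) (axis i 1))"

definition euler_motion ::
  "(real^3) set \<Rightarrow> (real^3 \<Rightarrow> real) \<Rightarrow> (real^3 \<Rightarrow> real) \<Rightarrow> (real \<Rightarrow> real^3) \<Rightarrow>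
   (real \<Rightarrow> real^3) \<Rightarrow> (real \<Rightarrow> real^3) \<Rightarrow> (real \<Rightarrow> real^3) \<Rightarrow> (real \<Rightarrow> real^3) \<Rightarrow> bool" where
  "euler_motion S \<rho> \<phi> \<omega> M \<alpha> \<beta> \<gamma> \<longleftrightarrow>
     (\<forall>t. M t = inertia_tensor S \<rho> *v \<omega> t) \<and>
     (\<forall>t. norm (\<alpha> t) = 1 \<and> norm (\<beta> t) = 1 \<and> norm (\<gamma> t) = 1 \<and>
          \<alpha> t \<bullet> \<beta> t = 0 \<and> \<beta> t \<bullet> \<gamma> t = 0 \<and> \<gamma> t \<bullet> \<alpha> t = 0) \<and>
     (\<forall>t. (M has_vector_derivative
             (cross3 (M t) (\<omega> t)
              + cross3 (grad (\<lambda>x. body_potential S \<rho> \<phi> x (\<beta> t) (\<gamma> t)) (\<alpha> t)) (\<alpha> t)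
              + cross3 (grad (\<lambda>x. body_potential S \<rho> \<phi> (\<alpha> t) x (\<gamma> t)) (\<beta> t)) (\<beta> t)
              + cross3 (grad (\<lambda>x. body_potential S \<rho> \<phi> (\<alpha> t) (\<beta> t) x) (\<gamma> t)) (\<gamma> t))) (at t)) \<and>
     (\<forall>t. (\<alpha> has_vector_derivative cross3 (\<alpha> t) (\<omega> t)) (at t)) \<and>
     (\<forall>t. (\<beta> has_vector_derivative cross3 (\<beta> t) (\<omega> t)) (at t)) \<and>
     (\<forall>t. (\<gamma> has_vector_derivative cross3 (\<gamma> t) (\<omega> t)) (at t))"

text \<open>The identification of vectors with skew-symmetric matrices: \<open>skew v *v x = cross3 v x\<close>.\<close>

definition skew :: "real^3 \<Rightarrow> real^3^3" where
  "skew v = vector [vector [0, - v$3, v$2], vector [v$3, 0, - v$1], vector [- v$2, v$1, 0]]"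

definition lax_L :: "real^3^3 \<Rightarrow> real^3^3 \<Rightarrow> real^3^3 \<Rightarrow> complex \<Rightarrow> complex^3^3" where
  "lax_L B M u E = (\<chi> i j. of_real (B$i$j) * E\<^sup>2 + of_real (M$i$j) * E + of_real (u$i$j))"

definition lax_Q :: "real^3^3 \<Rightarrow> real^3^3 \<Rightarrow> complex \<Rightarrow> complex^3^3" where
  "lax_Q \<omega> I E = (\<chi> i j. of_real (\<omega>$i$j) - E * of_real (I$i$j))"

text \<open>The equation \<open>[L, d/dt + Q] = 0\<close> of operators says \<open>dL/dt = L Q - Q L\<close>.\<close>

definition lax_equation ::
  "(real \<Rightarrow> complex \<Rightarrow> complex^3^3) \<Rightarrow> (real \<Rightarrow> complex \<Rightarrow> complex^3^3) \<Rightarrow> bool" where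
  "lax_equation L Q \<longleftrightarrow>
     (\<forall>E t. ((\<lambda>s. L s E) has_vector_derivative (L t E ** Q t E - Q t E ** L t E)) (at t))"

definition spectral_poly :: "(complex \<Rightarrow> complex^3^3) \<Rightarrow> complex \<Rightarrow> complex \<Rightarrow> complex" where
  "spectral_poly L w E = det (L E - mat w)"


section \<open>Compact Riemann surfaces and smooth completions of plane curves\<close>

type_synonym 'p chart = "'p set \<times> ('p \<Rightarrow> complex)"

definition transition :: "'p chart \<Rightarrow> 'p chart \<Rightarrow> complex \<Rightarrow> complex" where
  "transition c d = snd d \<circ> inv_into (fst c) (snd c)"

definition riemann_surface :: "'p topology \<Rightarrow> 'p chart set \<Rightarrow> bool" where
  "riemann_surface X \<A> \<longleftrightarrow> Hausdorff_space X \<and>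
     topspace X = (\<Union>(U, \<phi>)\<in>\<A>. U) \<and>
     (\<forall>(U, \<phi>)\<in>\<A>. openin X U \<and> open (\<phi> ` U) \<and>
        homeomorphic_map (subtopology X U) (top_of_set (\<phi> ` U)) \<phi>) \<and>
     (\<forall>c\<in>\<A>. \<forall>d\<in>\<A>. transition c d holomorphic_on snd c ` (fst c \<inter> fst d))"

definition compact_riemann_surface :: "'p topology \<Rightarrow> 'p chart set \<Rightarrow> bool" where
  "compact_riemann_surface X \<A> \<longleftrightarrow>
     riemann_surface X \<A> \<and> compact_space X \<and> connected_space X \<and> topspace X \<noteq> {}"

definition holomorphic_function_on :: "'p chart set \<Rightarrow> ('p \<Rightarrow> complex) \<Rightarrow> 'p set \<Rightarrow> bool" where
  "holomorphic_function_on \<A> f W \<longleftrightarrow>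
     (\<forall>(U, \<phi>)\<in>\<A>. (f \<circ> inv_into U \<phi>) holomorphic_on \<phi> ` (U \<inter> W))"

definition holomorphic_self_map :: "'p topology \<Rightarrow> 'p chart set \<Rightarrow> ('p \<Rightarrow> 'p) \<Rightarrow> bool" where
  "holomorphic_self_map X \<A> \<sigma> \<longleftrightarrow> continuous_map X X \<sigma> \<and>
     (\<forall>(U, \<phi>)\<in>\<A>. \<forall>(V, \<psi>)\<in>\<A>.
        (\<psi> \<circ> \<sigma> \<circ> inv_into U \<phi>) holomorphic_on \<phi> ` (U \<inter> \<sigma> -` V))"

text \<open>
  A smooth completion of the affine curve \<open>R w E = 0\<close>: a compact connected Riemann surface with
  finitely many points at infinity, whose complement is mapped by the coordinate functions
  \<open>(w, E)\<close> properly onto the curve and injectively up to finitely many points. These properties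
  determine the surface and the functions up to isomorphism.
\<close>

definition smooth_completion ::
  "(complex \<Rightarrow> complex \<Rightarrow> complex) \<Rightarrow> 'p topology \<Rightarrow> 'p chart set \<Rightarrow>
   ('p \<Rightarrow> complex) \<Rightarrow> ('p \<Rightarrow> complex) \<Rightarrow> 'p set \<Rightarrow> bool" where
  "smooth_completion R X \<A> w E Pinf \<longleftrightarrow>
     compact_riemann_surface X \<A> \<and> finite Pinf \<and> Pinf \<subseteq> topspace X \<and>
     holomorphic_function_on \<A> w (topspace X - Pinf) \<and>
     holomorphic_function_on \<A> E (topspace X - Pinf) \<and>
     (\<lambda>p. (w p, E p)) ` (topspace X - Pinf) = {(x, y). R x y = 0} \<and>
     (\<exists>F. finite F \<and> inj_on (\<lambda>p. (w p, E p)) (topspace X - Pinf - F)) \<and>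
     (\<forall>p\<in>Pinf. filterlim (\<lambda>q. (w q, E q)) at_infinity (atin X p))"

definition spectral_involution ::
  "'p topology \<Rightarrow> 'p chart set \<Rightarrow> ('p \<Rightarrow> complex) \<Rightarrow> ('p \<Rightarrow> complex) \<Rightarrow> 'p set \<Rightarrow> ('p \<Rightarrow> 'p) \<Rightarrow> bool"
where
  "spectral_involution X \<A> w E Pinf \<sigma> \<longleftrightarrow>
     holomorphic_self_map X \<A> \<sigma> \<and> (\<forall>p\<in>topspace X. \<sigma> (\<sigma> p) = p) \<and>
     (\<forall>p\<in>topspace X - Pinf. \<sigma> p \<in> topspace X - Pinf \<and> w (\<sigma> p) = w p \<and> E (\<sigma> p) = - E p)"

text \<open>For compact connected orientable surfaces the first homology group determines the genus.\<close>

definition has_genus :: "'p topology \<Rightarrow> nat \<Rightarrow> bool" where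
  "has_genus X g \<longleftrightarrow> homology_group 1 X \<cong> free_Abelian_group {..<2 * g}"

definition orbit_quotient :: "'p topology \<Rightarrow> ('p \<Rightarrow> 'p) \<Rightarrow> 'p set topology \<Rightarrow> bool" where
  "orbit_quotient X \<sigma> Y \<longleftrightarrow> quotient_map X Y (\<lambda>p. {p, \<sigma> p})"


section \<open>Holomorphic differentials and their periods\<close>

text \<open>
  A differential is given by its coefficient functions: in the chart \<open>c\<close> with coordinate \<open>z\<close>
  it is \<open>\<eta> c z dz\<close>.
\<close>

type_synonym 'p differential = "'p chart \<Rightarrow> complex \<Rightarrow> complex"

definition holomorphic_differential :: "'p chart set \<Rightarrow> 'p differential \<Rightarrow> bool" where
  "holomorphic_differential \<A> \<eta> \<longleftrightarrow>
     (\<forall>c\<in>\<A>. \<eta> c holomorphic_on snd c ` fst c) \<and>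
     (\<forall>c\<in>\<A>. \<forall>d\<in>\<A>. \<forall>z\<in>snd c ` (fst c \<inter> fst d).
        \<eta> c z = \<eta> d (transition c d z) * deriv (transition c d) z)"

definition same_differential :: "'p chart set \<Rightarrow> 'p differential \<Rightarrow> 'p differential \<Rightarrow> bool" where
  "same_differential \<A> \<eta> \<zeta> \<longleftrightarrow> (\<forall>c\<in>\<A>. \<forall>z\<in>snd c ` fst c. \<eta> c z = \<zeta> c z)"

text \<open>
  Integration along an arbitrary continuous path \<open>g\<close> on \<open>[0, 1]\<close> by means of a primitive \<open>f\<close>
  along the path, which is locally the composition of \<open>g\<close> with a primitive \<open>G\<close> of \<open>\<eta>\<close>.
\<close>

definition has_path_integral ::
  "'p chart set \<Rightarrow> 'p differential \<Rightarrow> (real \<Rightarrow> 'p) \<Rightarrow> complex \<Rightarrow> bool" where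
  "has_path_integral \<A> \<eta> g I \<longleftrightarrow>
     (\<exists>f. I = f 1 - f 0 \<and>
        (\<forall>t\<in>{0..1}. \<exists>(U, \<phi>)\<in>\<A>. \<exists>G W \<delta>. open W \<and> W \<subseteq> \<phi> ` U \<and> 0 < \<delta> \<and>
           (\<forall>z\<in>W. (G has_field_derivative \<eta> (U, \<phi>) z) (at z)) \<and>
           (\<forall>s\<in>{0..1}. \<bar>s - t\<bar> < \<delta> \<longrightarrow> g s \<in> U \<and> \<phi> (g s) \<in> W \<and> f s = G (\<phi> (g s)))))"

definition simplex_path :: "((nat \<Rightarrow> real) \<Rightarrow> 'p) \<Rightarrow> real \<Rightarrow> 'p" where
  "simplex_path f t = f (\<lambda>i. if i = 0 then 1 - t else if i = 1 then t else 0)"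

definition has_chain_integral :: "'p chart set \<Rightarrow> 'p differential \<Rightarrow> 'p chain \<Rightarrow> complex \<Rightarrow> bool" where
  "has_chain_integral \<A> \<eta> c I \<longleftrightarrow>
     (\<exists>J. (\<forall>f\<in>Poly_Mapping.keys c. has_path_integral \<A> \<eta> (simplex_path f) (J f)) \<and>
          I = (\<Sum>f\<in>Poly_Mapping.keys c. of_int (Poly_Mapping.lookup c f) * J f))"

text \<open>The elements of a homology class \<open>h\<close> are the cycles that represent it.\<close>

definition has_period :: "'p chart set \<Rightarrow> 'p differential \<Rightarrow> 'p chain set \<Rightarrow> complex \<Rightarrow> bool" where
  "has_period \<A> \<eta> h I \<longleftrightarrow> (\<forall>c\<in>h. has_chain_integral \<A> \<eta> c I)"


section \<open>Intersection numbers and canonical bases of cycles\<close>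

text \<open>Closed curves are parametrized by the reals with period 1.\<close>

definition C1_loop :: "'p topology \<Rightarrow> 'p chart set \<Rightarrow> (real \<Rightarrow> 'p) \<Rightarrow> bool" where
  "C1_loop X \<A> g \<longleftrightarrow> continuous_map euclideanreal X g \<and> (\<forall>s. g (s + 1) = g s) \<and>
     (\<forall>(U, \<phi>)\<in>\<A>. \<exists>D. (\<forall>s\<in>g -` U. ((\<phi> \<circ> g) has_vector_derivative D s) (at s)) \<and>
                         continuous_on (g -` U) D)"

definition loop_class :: "'p topology \<Rightarrow> (real \<Rightarrow> 'p) \<Rightarrow> 'p chain set" where
  "loop_class X g =
     homologous_rel_set 1 X {} (frag_of (restrict (\<lambda>x. g (x 1)) (standard_simplex 1)))"

text \<open>
  The sign of the crossing of \<open>g\<close> and \<open>h\<close> at \<open>g s = h t\<close>: positive if the tangent vectors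
  of \<open>g\<close> and \<open>h\<close> form a positive basis, zero if they are dependent. Transition maps being
  conformal, it does not depend on the chart.
\<close>

definition crossing_sign :: "'p chart set \<Rightarrow> (real \<Rightarrow> 'p) \<Rightarrow> (real \<Rightarrow> 'p) \<Rightarrow> real \<Rightarrow> real \<Rightarrow> real" where
  "crossing_sign \<A> g h s t =
     (let \<phi> = snd (SOME c. c \<in> \<A> \<and> g s \<in> fst c)
      in sgn (Im (cnj (vector_derivative (\<phi> \<circ> g) (at s)) * vector_derivative (\<phi> \<circ> h) (at t))))"

definition has_intersection_number ::
  "'p topology \<Rightarrow> 'p chart set \<Rightarrow> 'p chain set \<Rightarrow> 'p chain set \<Rightarrow> int \<Rightarrow> bool" where
  "has_intersection_number X \<A> x y n \<longleftrightarrow>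
     (\<exists>g h. C1_loop X \<A> g \<and> C1_loop X \<A> h \<and> loop_class X g = x \<and> loop_class X h = y \<and>
        (let K = {(s, t). s \<in> {0..<1} \<and> t \<in> {0..<1} \<and> g s = h t}
         in finite K \<and> (\<forall>(s, t)\<in>K. crossing_sign \<A> g h s t \<noteq> 0) \<and>
            of_int n = (\<Sum>(s, t)\<in>K. crossing_sign \<A> g h s t)))"

definition canonical_basis ::
  "'p topology \<Rightarrow> 'p chart set \<Rightarrow> ('n::finite \<Rightarrow> 'p chain set) \<Rightarrow> ('n \<Rightarrow> 'p chain set) \<Rightarrow> bool" where
  "canonical_basis X \<A> a b \<longleftrightarrow>
     (let H = homology_group 1 X in
      (\<forall>j. a j \<in> carrier H \<and> b j \<in> carrier H) \<and>
      (\<forall>x\<in>carrier H. \<exists>!mn :: (int^'n) \<times> (int^'n).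
         x = finprod H (\<lambda>j. a j [^]\<^bsub>H\<^esub> (fst mn $ j)) UNIV
             \<otimes>\<^bsub>H\<^esub> finprod H (\<lambda>j. b j [^]\<^bsub>H\<^esub> (snd mn $ j)) UNIV) \<and>
      (\<forall>j k. has_intersection_number X \<A> (a j) (a k) 0 \<and>
             has_intersection_number X \<A> (b j) (b k) 0 \<and>
             has_intersection_number X \<A> (a j) (b k) (if j = k then 1 else 0)))"

text \<open>Indices \<open>1, 2, 3, 4\<close> stand for \<open>1, 2, 3\<close> and the index of the cycles and
  differentials with a tilde.\<close>

definition sigma_adapted ::
  "'p topology \<Rightarrow> ('p \<Rightarrow> 'p) \<Rightarrow> (4 \<Rightarrow> 'p chain set) \<Rightarrow> bool" where
  "sigma_adapted X \<sigma> a \<longleftrightarrow>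
     (let H = homology_group 1 X; \<sigma>H = hom_induced 1 X {} X {} \<sigma> in
      \<sigma>H (a 1) \<otimes>\<^bsub>H\<^esub> a 4 = \<one>\<^bsub>H\<^esub> \<and> \<sigma>H (a 2) \<otimes>\<^bsub>H\<^esub> a 2 = \<one>\<^bsub>H\<^esub> \<and> \<sigma>H (a 3) \<otimes>\<^bsub>H\<^esub> a 3 = \<one>\<^bsub>H\<^esub>)"

definition normalized_differentials ::
  "'p chart set \<Rightarrow> ('n::finite \<Rightarrow> 'p chain set) \<Rightarrow> ('n \<Rightarrow> 'p differential) \<Rightarrow> bool" where
  "normalized_differentials \<A> a u \<longleftrightarrow>
     (\<forall>k. holomorphic_differential \<A> (u k)) \<and>
     (\<forall>\<eta>. holomorphic_differential \<A> \<eta> \<longrightarrow>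
        (\<exists>!c::complex^'n. same_differential \<A> \<eta> (\<lambda>ch z. \<Sum>k\<in>UNIV. c$k * u k ch z))) \<and>
     (\<forall>j k. has_period \<A> (u k) (a j) (if j = k then 1 else 0))"

definition period_matrix ::
  "'p chart set \<Rightarrow> ('n::finite \<Rightarrow> 'p chain set) \<Rightarrow> ('n \<Rightarrow> 'p differential) \<Rightarrow> complex^'n^'n \<Rightarrow> bool" where
  "period_matrix \<A> b u \<Omega> \<longleftrightarrow> (\<forall>j k. has_period \<A> (u k) (b j) (\<Omega>$j$k))"

definition prym_differential :: "(4 \<Rightarrow> 'p differential) \<Rightarrow> 3 \<Rightarrow> 'p differential" where
  "prym_differential u k =
     (if k = 1 then (\<lambda>c z. u 1 c z + u 4 c z) else if k = 2 then u 2 else u 3)"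

definition prym_period_matrix ::
  "'p chart set \<Rightarrow> (4 \<Rightarrow> 'p chain set) \<Rightarrow> (4 \<Rightarrow> 'p differential) \<Rightarrow> complex^3^3 \<Rightarrow> bool" where
  "prym_period_matrix \<A> b u P \<longleftrightarrow>
     (\<forall>k. (\<exists>I. has_period \<A> (prym_differential u k) (b 1) I \<and> P$1$k = 2 * I) \<and>
          has_period \<A> (prym_differential u k) (b 2) (P$2$k) \<and>
          has_period \<A> (prym_differential u k) (b 3) (P$3$k))"


section \<open>Jacobi and Prym varieties\<close>

definition period_lattice :: "complex^'n^'n \<Rightarrow> (complex^'n) set" where
  "period_lattice \<Omega> = {p + \<Omega> *v q | p q. (\<forall>j. p$j \<in> \<int>) \<and> (\<forall>j. q$j \<in> \<int>)}"

definition sigma_star :: "complex^4 \<Rightarrow> complex^4" where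
  "sigma_star z = - vector [z$4, z$2, z$3, z$1]"

text \<open>The preimage in \<open>complex^4\<close> of the Prym variety, a subgroup of the Jacobi variety
  \<open>complex^4 / period_lattice \<Omega>\<close>.\<close>

definition prym_preimage :: "complex^4^4 \<Rightarrow> (complex^4) set" where
  "prym_preimage \<Omega> = {z. sigma_star z + z \<in> period_lattice \<Omega>}"

text \<open>Tangent vectors of a complex subgroup of a torus are the directions of its one-parameter
  subgroups.\<close>

definition tangent_to_prym :: "complex^4^4 \<Rightarrow> complex^4 \<Rightarrow> bool" where
  "tangent_to_prym \<Omega> v \<longleftrightarrow> (\<forall>s. s *s v \<in> prym_preimage \<Omega>)"


section \<open>Theta functions\<close>

definition siegel_upper_half :: "complex^'n^'n \<Rightarrow> bool" where
  "siegel_upper_half \<Omega> \<longleftrightarrow> transpose \<Omega> = \<Omega> \<and>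
     (\<forall>x::real^'n. x \<noteq> 0 \<longrightarrow> 0 < x \<bullet> (map_matrix Im \<Omega> *v x))"

text \<open>The bilinear, not the Hermitian, pairing.\<close>

definition pairing :: "complex^'n \<Rightarrow> complex^'n \<Rightarrow> complex" where
  "pairing x y = (\<Sum>j\<in>UNIV. x$j * y$j)"

definition theta_char ::
  "complex^'n \<Rightarrow> complex^'n \<Rightarrow> complex^'n \<Rightarrow> complex^'n^'n \<Rightarrow> complex" where
  "theta_char a b z \<Omega> =
     (\<Sum>\<^sub>\<infinity>l::int^'n. let v = (\<chi> j. of_int (l$j)) + a in
        exp (pi * \<i> * pairing v (\<Omega> *v v) + 2 * pi * \<i> * pairing v (z + b)))"

definition theta :: "complex^'n \<Rightarrow> complex^'n^'n \<Rightarrow> complex" where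
  "theta z \<Omega> = theta_char 0 0 z \<Omega>"

definition tilde :: "complex^4 \<Rightarrow> complex^3" where
  "tilde w = vector [w$1 + w$4, w$2, w$3]"

definition Delta :: "complex^3^3" where
  "Delta = (\<chi> i j. if i = j then (if i = 1 then 2 else 1) else 0)"

text \<open>The vector \<open>\<epsilon> = (e, 0, 0)\<close>.\<close>

definition eps :: "int \<Rightarrow> complex^3" where
  "eps e = vector [of_int e, 0, 0]"

definition c_coeff :: "complex^4^4 \<Rightarrow> complex^3^3 \<Rightarrow> int \<Rightarrow> complex^4 \<Rightarrow> complex" where
  "c_coeff \<Omega> P e \<gamma> =
     (\<Sum>\<^sub>\<infinity>m::int. let v = vector [of_int m, 0, 0, of_int (e - m)]; d = matrix_inv Delta *v eps e in
        exp (pi * \<i> * pairing v (\<Omega> *v v) + pi * \<i> * pairing (eps e) (tilde \<gamma>)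
             - 2 * pi * \<i> * pairing v \<gamma> - pi * \<i> * pairing d (P *v d)))"

end

theory Submission
  imports Defs "HOL-Complex_Analysis.Cauchy_Integral_Formula"
begin

text \<open>
  The four-dimensional theta series is resummed. A lattice vector \<open>l\<close> is written uniquely as
  \<open>(k, l\<^sub>2, l\<^sub>3, k) + (m, 0, 0, e - m)\<close> with \<open>e \<in> {0, 1}\<close>. If \<open>\<Omega>\<close> is invariant under exchanging the
  indices 1 and 4, the quadratic form splits as \<open>\<Omega>[l] = \<Omega>[(m, 0, 0, e - m)] - P[\<delta>] + P[(k, l\<^sub>2, l\<^sub>3) + \<delta>]\<close>
  with \<open>\<delta> = (e/2, 0, 0)\<close>, so the sum over \<open>m\<close> is a coefficient \<open>c\<^sub>e\<close> and the remaining sum is a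
  theta function of \<open>P\<close>. The coefficients are constant along directions \<open>(U\<^sub>1, U\<^sub>2, U\<^sub>3, U\<^sub>1)\<close>.

  The invariance of \<open>\<Omega>\<close> comes from the involution: comparing \<open>a\<close>-periods shows that the pullback of
  the \<open>k\<close>-th normalized differential is minus the one with exchanged index, and then the
  \<open>b\<close>-periods are compared.
\<close>

section \<open>Convergence of theta series\<close>

text \<open>The halves in the characteristic measure a failure of splitting. Lattice vectors fixed
  by exchanging the indices 1 and 4, together with the multiples of (1, 0, 0, -1), span only the
  vectors whose first and last entries have an even sum. This sublattice has index 2,
  \<open>e\<close> labels its two cosets, and averaging (0, 0, 0, e) with its image under the
  exchange yields the half-integral shift. For an invariant \<Omega> the fixed and the anti-fixed
  part are orthogonal, which is why the exponent separates.

  On the geometric side the obstacle is that an integral is specified by the mere existence of a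
  primitive along a continuous path, in charts that may change with the parameter. Comparing periods
  therefore rests on uniqueness of such integrals and on their behaviour under linear combinations
  and pullback. Independence of the representing cycle is built into \<open>has_period\<close>,
  which speaks about all cycles of a class; so the negated image of a cycle under \<sigma> can be
  inserted directly.\<close>

lemma exp_minus_abs_summable_on_int: "(\<lambda>k::int. exp (- \<bar>real_of_int k\<bar>)) summable_on UNIV"
proof -
  have N: "(\<lambda>n::nat. exp (- real n)) summable_on UNIV"
  proof (rule norm_summable_imp_summable_on)
    have "summable (\<lambda>n::nat. exp (-1::real) ^ n)"
      by (rule summable_geometric) simp
    then show "summable (\<lambda>n. norm (exp (- real n)))"
      by (simp flip: exp_of_nat_mult)
  qed
  have P: "(\<lambda>k::int. exp (- \<bar>real_of_int k\<bar>)) summable_on range int"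
    by (subst summable_on_reindex) (auto simp: o_def N)
  have M: "(\<lambda>k::int. exp (- \<bar>real_of_int k\<bar>)) summable_on range (\<lambda>n. - int n)"
    by (subst summable_on_reindex) (auto simp: o_def N inj_def)
  have "range int \<union> range (\<lambda>n. - int n) = UNIV"
    using int_cases2 by blast
  then show ?thesis
    using summable_on_union[OF P M] by simp
qed

text \<open>The terms are products over the coordinates. Every finite partial sum is dominated by a
  sum over a box, which factors into one-dimensional sums, so a power of the one-dimensional total
  bounds them all.\<close>

lemma exp_minus_l1_summable_on:
  "(\<lambda>l::int^'n::finite. exp (- (\<Sum>j\<in>UNIV. \<bar>real_of_int (l$j)\<bar>))) summable_on UNIV"
proof (rule nonneg_bdd_above_summable_on)
  let ?g = "\<lambda>k::int. exp (- \<bar>real_of_int k\<bar>)"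
  let ?h = "\<lambda>l::int^'n. exp (- (\<Sum>j\<in>UNIV. \<bar>real_of_int (l$j)\<bar>))"
  show "bdd_above (sum ?h ` {F. F \<subseteq> UNIV \<and> finite F})"
  proof (rule bdd_aboveI2)
    fix F :: "(int^'n) set"
    assume "F \<in> {F. F \<subseteq> UNIV \<and> finite F}"
    then have "finite F"
      by simp
    \<comment> \<open>All coordinates that occur in \<open>F\<close>; the box over \<open>I\<close>
      is the smallest cube of this form containing \<open>F\<close>.\<close>
    define I where "I = (\<Union>l\<in>F. range (\<lambda>j. l$j))"
    have I: "finite I"
      using \<open>finite F\<close> by (simp add: I_def)
    let ?v = "\<lambda>f. (\<chi> j. f j) :: int^'n"
    have F: "F \<subseteq> ?v ` (UNIV \<rightarrow>\<^sub>E I)"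
    proof
      fix l
      assume "l \<in> F"
      then have "(\<lambda>j. l$j) \<in> UNIV \<rightarrow>\<^sub>E I"
        by (auto simp: I_def)
      then show "l \<in> ?v ` (UNIV \<rightarrow>\<^sub>E I)"
        by (intro image_eqI[where x = "\<lambda>j. l$j"]) simp_all
    qed
    have inj: "inj_on ?v (UNIV \<rightarrow>\<^sub>E I)"
      by (auto simp: inj_on_def vec_eq_iff)
    have "sum ?h F \<le> sum ?h (?v ` (UNIV \<rightarrow>\<^sub>E I))"
      using F I by (intro sum_mono2 finite_imageI finite_PiE) auto
    also have "\<dots> = (\<Sum>f\<in>(UNIV::'n set) \<rightarrow>\<^sub>E I. \<Prod>j\<in>UNIV. ?g (f j))"
      by (simp add: sum.reindex[OF inj] exp_sum flip: sum_negf)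
    also have "\<dots> = (\<Prod>j\<in>(UNIV::'n set). \<Sum>k\<in>I. ?g k)"
      by (rule prod_sum_PiE[symmetric]) (use I in auto)
    also have "\<dots> \<le> (\<Prod>j\<in>(UNIV::'n set). infsum ?g UNIV)"
      using I exp_minus_abs_summable_on_int
      by (intro prod_mono conjI sum_nonneg finite_sum_le_infsum) auto
    finally show "sum ?h F \<le> (\<Prod>j\<in>(UNIV::'n set). infsum ?g UNIV)" .
  qed
qed simp

text \<open>The constant is the minimum of the form on the compact unit sphere; homogeneity of
  degree two carries the bound to all vectors.\<close>

lemma positive_definite_lower_bound:
  fixes Y :: "real^'n::finite^'n"
  assumes "\<And>x. x \<noteq> 0 \<Longrightarrow> 0 < x \<bullet> (Y *v x)"
  obtains c where "0 < c" "\<And>x. c * (norm x)\<^sup>2 \<le> x \<bullet> (Y *v x)"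
proof -
  have "continuous_on (sphere 0 1) (\<lambda>x. x \<bullet> (Y *v x))"
    by (intro continuous_intros)
  then obtain x0 where x0: "x0 \<in> sphere 0 1"
    "\<And>x. x \<in> sphere 0 1 \<Longrightarrow> x0 \<bullet> (Y *v x0) \<le> x \<bullet> (Y *v x)"
    using continuous_attains_inf[of "sphere 0 1" "\<lambda>x. x \<bullet> (Y *v x)"] by auto
  show ?thesis
  proof
    show "0 < x0 \<bullet> (Y *v x0)"
      using x0(1) by (intro assms) auto
    show "x0 \<bullet> (Y *v x0) * (norm x)\<^sup>2 \<le> x \<bullet> (Y *v x)" for x
    proof (cases "x = 0")
      case False
      define y where "y = x /\<^sub>R norm x"
      have "x0 \<bullet> (Y *v x0) \<le> y \<bullet> (Y *v y)"
        using False by (intro x0) (simp add: y_def)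
      then have "x0 \<bullet> (Y *v x0) * (norm x)\<^sup>2 \<le> (y \<bullet> (Y *v y)) * (norm x)\<^sup>2"
        by (intro mult_right_mono) auto
      also have "\<dots> = x \<bullet> (Y *v x)"
        using False by (simp add: y_def matrix_vector_mult_scaleR power2_eq_square field_simps)
      finally show ?thesis .
    qed simp
  qed
qed

lemma norm_theta_term:
  fixes l :: "int^'n::finite" and \<Omega> :: "complex^'n^'n"
  defines "x \<equiv> (\<chi> j. real_of_int (l$j)) :: real^'n"
    and "v \<equiv> (\<chi> j. of_int (l$j)) :: complex^'n"
  shows "norm (exp (pi * \<i> * pairing v (\<Omega> *v v) + 2 * pi * \<i> * pairing v z)) =
         exp (- pi * (x \<bullet> (map_matrix Im \<Omega> *v x)) - 2 * pi * (x \<bullet> (\<chi> j. Im (z$j))))"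
proof -
  have "Im (pairing v (\<Omega> *v v)) = x \<bullet> (map_matrix Im \<Omega> *v x)"
    by (simp add: pairing_def matrix_vector_mult_def inner_vec_def x_def v_def map_matrix_def)
  moreover have "Im (pairing v z) = x \<bullet> (\<chi> j. Im (z$j))"
    by (simp add: pairing_def inner_vec_def x_def v_def)
  ultimately show ?thesis
    by simp
qed

text \<open>The Gaussian decay from Im \<Omega> beats the linear growth caused by Im z, with enough
  left over to dominate the l1 exponential.\<close>

lemma theta_terms_abs_summable:
  fixes \<Omega> :: "complex^'n::finite^'n"
  assumes "siegel_upper_half \<Omega>"
  shows "(\<lambda>l::int^'n. norm (let v = (\<chi> j. of_int (l$j)) in
            exp (pi * \<i> * pairing v (\<Omega> *v v) + 2 * pi * \<i> * pairing v z))) summable_on UNIV"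
    (is "(\<lambda>l. norm (?f l)) summable_on UNIV")
proof -
  let ?Y = "map_matrix Im \<Omega>"
  define y where "y = ((\<chi> j. Im (z$j)) :: real^'n)"
  let ?h = "\<lambda>l::int^'n. exp (- (\<Sum>j\<in>UNIV. \<bar>real_of_int (l$j)\<bar>))"
  have "0 < x \<bullet> (?Y *v x)" if "x \<noteq> 0" for x
    using assms that by (simp add: siegel_upper_half_def)
  then obtain c where c: "0 < c" "\<And>x. c * (norm x)\<^sup>2 \<le> x \<bullet> (?Y *v x)"
    using positive_definite_lower_bound[of ?Y] by blast
  \<comment> \<open>\<open>D\<close> collects the two linear contributions, the l1 norm and the term
    with Im z, both bounded by multiples of \<open>norm x\<close>. \<open>K\<close> is the maximum
    over real N of D N - pi c N^2, found by completing the square.\<close>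
  define D where "D = real CARD('n) + 2 * pi * norm y"
  define K where "K = D\<^sup>2 / (4 * (pi * c))"
  have "norm (?f l) \<le> exp K * ?h l" for l
  proof -
    define x where "x = ((\<chi> j. real_of_int (l$j)) :: real^'n)"
    have "(\<Sum>j\<in>UNIV. \<bar>real_of_int (l$j)\<bar>) \<le> (\<Sum>j\<in>(UNIV::'n set). norm x)"
      by (rule sum_mono) (metis component_le_norm_cart vec_lambda_beta x_def)
    then have l1: "(\<Sum>j\<in>UNIV. \<bar>real_of_int (l$j)\<bar>) \<le> real CARD('n) * norm x"
      by simp
    have "- (x \<bullet> y) \<le> norm x * norm y"
      by (metis abs_ge_minus_self Cauchy_Schwarz_ineq2 order.trans)
    then have lin: "- 2 * pi * (x \<bullet> y) \<le> 2 * pi * norm y * norm x"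
      using mult_left_mono[of "- (x \<bullet> y)" "norm x * norm y" "2 * pi"] by (simp add: mult_ac del: mult_le_cancel_left_pos)
    have quad: "pi * c * (norm x)\<^sup>2 \<le> pi * (x \<bullet> (?Y *v x))"
      unfolding mult.assoc by (rule mult_left_mono[OF c(2)]) simp
    have "0 \<le> (2 * (pi * c) * norm x - D)\<^sup>2"
      by (rule zero_le_power2)
    then have "4 * (pi * c) * (D * norm x - pi * c * (norm x)\<^sup>2) \<le> D\<^sup>2"
      by (simp add: power2_eq_square algebra_simps)
    then have "D * norm x - pi * c * (norm x)\<^sup>2 \<le> K"
      using c(1) by (simp add: K_def pos_le_divide_eq mult.commute)
    then have "- pi * (x \<bullet> (?Y *v x)) - 2 * pi * (x \<bullet> y) \<le> K - (\<Sum>j\<in>UNIV. \<bar>real_of_int (l$j)\<bar>)"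
      using l1 lin quad unfolding D_def distrib_right by linarith
    moreover have "norm (?f l) = exp (- pi * (x \<bullet> (?Y *v x)) - 2 * pi * (x \<bullet> y))"
      unfolding Let_def norm_theta_term x_def y_def ..
    ultimately have "norm (?f l) \<le> exp (K - (\<Sum>j\<in>UNIV. \<bar>real_of_int (l$j)\<bar>))"
      by (simp only: exp_le_cancel_iff)
    then show ?thesis
      by (simp add: exp_diff exp_minus divide_inverse)
  qed
  moreover have "(\<lambda>l. exp K * ?h l) summable_on UNIV"
    by (intro summable_on_cmult_right exp_minus_l1_summable_on)
  ultimately show ?thesis
    by (intro Infinite_Sum.abs_summable_on_comparison_test')
qed

section \<open>Reduction of theta functions to Prym theta functions\<close>

definition prym_shift :: "int \<Rightarrow> int \<Rightarrow> int^3 \<Rightarrow> int^4" where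
  "prym_shift e m n = vector [n$1 + m, n$2, n$3, n$1 + e - m]"

lemma vector_4 [simp]:
  "(vector [w,x,y,z] :: 'a::zero^4)$1 = w" "(vector [w,x,y,z] :: 'a^4)$2 = x"
  "(vector [w,x,y,z] :: 'a^4)$3 = y" "(vector [w,x,y,z] :: 'a^4)$4 = z"
  unfolding vector_def by simp_all

text \<open>First and last entry of the shifted vector add up to 2 n1 + e, so division with
  remainder by 2 recovers n1 and the parity \<open>e\<close>; then \<open>m\<close> is read off the
  first entry.\<close>

lemma bij_betw_prym_shift:
  "bij_betw (\<lambda>(e, m, n). prym_shift e m n) ({0, 1} \<times> UNIV) UNIV"
proof (rule bij_betw_byWitness[where f' = "\<lambda>l. ((l$1 + l$4) mod 2, l$1 - (l$1 + l$4) div 2,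
    vector [(l$1 + l$4) div 2, l$2, l$3])"])
  show "\<forall>p\<in>{0, 1} \<times> UNIV. (\<lambda>l. ((l$1 + l$4) mod 2, l$1 - (l$1 + l$4) div 2,
      vector [(l$1 + l$4) div 2, l$2, l$3])) ((\<lambda>(e, m, n). prym_shift e m n) p) = p"
    by (auto simp: prym_shift_def vec_eq_iff forall_3)
  show "\<forall>l\<in>UNIV. (\<lambda>(e, m, n). prym_shift e m n)
      ((l$1 + l$4) mod 2, l$1 - (l$1 + l$4) div 2, vector [(l$1 + l$4) div 2, l$2, l$3]) = l"
    by (auto simp: prym_shift_def vec_eq_iff forall_4) presburger
qed auto

text \<open>\<open>matrix_inv\<close> is a choice operator, so its value is only accessible through
  invertibility, here the nonzero determinant.\<close>

lemma matrix_inv_Delta_eps: "matrix_inv Delta *v eps e = vector [of_int e / 2, 0, 0]"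
proof -
  let ?d = "vector [of_int e / 2, 0, 0] :: complex^3"
  have "det Delta = 2"
    by (simp add: Delta_def det_3)
  then have "invertible Delta"
    by (simp add: invertible_det_nz)
  then have left_inverse: "matrix_inv Delta ** Delta = mat 1"
    unfolding matrix_inv_def invertible_def by (rule someI2_ex) simp
  have "Delta *v ?d = eps e"
    by (simp add: Delta_def eps_def vec_eq_iff forall_3 matrix_vector_mult_def sum_3)
  then have "matrix_inv Delta *v eps e = (matrix_inv Delta ** Delta) *v ?d"
    by (simp flip: matrix_vector_mul_assoc)
  then show ?thesis
    using left_inverse by simp
qed

text \<open>The interface between geometry and theta series: invariance of a symmetric \<Omega>
  under exchanging the indices 1 and 4, and the Prym periods written out in entries of \<Omega>. The
  first column of \<open>P\<close> comes from the sum of the differentials 1 and 4, the factor 2 in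
  its first row from the definition of the Prym period matrix. The invariance makes \<open>P\<close>
  symmetric.\<close>

definition prym_reduction :: "complex^4^4 \<Rightarrow> complex^3^3 \<Rightarrow> bool" where
  "prym_reduction \<Omega> P \<longleftrightarrow> transpose \<Omega> = \<Omega> \<and>
     \<Omega>$1$1 = \<Omega>$4$4 \<and> \<Omega>$4$2 = \<Omega>$1$2 \<and> \<Omega>$4$3 = \<Omega>$1$3 \<and>
     P = vector [vector [2 * (\<Omega>$1$1 + \<Omega>$1$4), 2 * \<Omega>$1$2, 2 * \<Omega>$1$3],
                 vector [\<Omega>$2$1 + \<Omega>$2$4, \<Omega>$2$2, \<Omega>$2$3],
                 vector [\<Omega>$3$1 + \<Omega>$3$4, \<Omega>$3$2, \<Omega>$3$3]]"

text \<open>Write l as the fixed vector (\<nu>1, n2, n3, \<nu>1) plus (m - e/2) times (1, 0, 0, -1).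
  The two summands are orthogonal for \<Omega>, and \<Omega> on the fixed one is P[\<nu>]. The case
  n = 0 reads \<Omega>[\<mu>] = P[d] + \<Omega>[(m - e/2)(1, 0, 0, -1)], which eliminates the
  anti-fixed part. In the linear term, passing from n to \<nu> adds half of the pairing of
  \<open>eps e\<close> with \<open>tilde z\<close>; the term with \<open>tilde (- z)\<close> takes
  it away again.\<close>

lemma theta_term_prym_shift:
  fixes n :: "int^3" and e m :: int
  assumes "prym_reduction \<Omega> P"
  defines "l \<equiv> (\<chi> j. of_int (prym_shift e m n $ j)) :: complex^4"
    and "\<mu> \<equiv> vector [of_int m, 0, 0, of_int (e - m)] :: complex^4"
    and "d \<equiv> vector [of_int e / 2, 0, 0] :: complex^3"
    and "\<nu> \<equiv> (\<chi> j. of_int (n$j)) + vector [of_int e / 2, 0, 0] :: complex^3"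
  shows "pi * \<i> * pairing l (\<Omega> *v l) + 2 * pi * \<i> * pairing l z =
    (pi * \<i> * pairing \<mu> (\<Omega> *v \<mu>) + pi * \<i> * pairing (eps e) (tilde (- z))
      - 2 * pi * \<i> * pairing \<mu> (- z) - pi * \<i> * pairing d (P *v d)) +
    (pi * \<i> * pairing \<nu> (P *v \<nu>) + 2 * pi * \<i> * pairing \<nu> (tilde z + 0))"
proof -
  have sym: "\<Omega>$j$k = \<Omega>$k$j" for j k
  proof -
    have "transpose \<Omega> $ k $ j = \<Omega>$k$j"
      using assms(1) by (simp add: prym_reduction_def)
    then show ?thesis
      by (simp add: transpose_def)
  qed
  have O: "\<Omega>$4$4 = \<Omega>$1$1" "\<Omega>$4$2 = \<Omega>$1$2" "\<Omega>$2$4 = \<Omega>$1$2" "\<Omega>$4$3 = \<Omega>$1$3" "\<Omega>$3$4 = \<Omega>$1$3"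
    "\<Omega>$4$1 = \<Omega>$1$4" "\<Omega>$2$1 = \<Omega>$1$2" "\<Omega>$3$1 = \<Omega>$1$3" "\<Omega>$3$2 = \<Omega>$2$3"
    using assms(1) sym by (auto simp: prym_reduction_def)
  have P: "P = vector [vector [2 * (\<Omega>$1$1 + \<Omega>$1$4), 2 * \<Omega>$1$2, 2 * \<Omega>$1$3],
                 vector [2 * \<Omega>$1$2, \<Omega>$2$2, \<Omega>$2$3],
                 vector [2 * \<Omega>$1$3, \<Omega>$2$3, \<Omega>$3$3]]"
    using assms(1) O by (simp add: prym_reduction_def)
  have quad: "pairing l (\<Omega> *v l) = pairing \<mu> (\<Omega> *v \<mu>) - pairing d (P *v d) + pairing \<nu> (P *v \<nu>)"
    unfolding P
    by (simp add: pairing_def matrix_vector_mult_def sum_4 sum_3 l_def \<mu>_def d_def \<nu>_def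
        prym_shift_def O) (simp add: field_simps)
  have lin: "2 * pairing l z = pairing (eps e) (tilde (- z)) - 2 * pairing \<mu> (- z) + 2 * pairing \<nu> (tilde z)"
    by (simp add: pairing_def sum_4 sum_3 l_def \<mu>_def \<nu>_def eps_def tilde_def prym_shift_def)
      (simp add: field_simps)
  have "pi * \<i> * pairing l (\<Omega> *v l) + 2 * pi * \<i> * pairing l z =
      pi * \<i> * pairing l (\<Omega> *v l) + pi * \<i> * (2 * pairing l z)"
    by simp
  also have "\<dots> = (pi * \<i> * pairing \<mu> (\<Omega> *v \<mu>) + pi * \<i> * pairing (eps e) (tilde (- z))
      - 2 * pi * \<i> * pairing \<mu> (- z) - pi * \<i> * pairing d (P *v d)) +
    (pi * \<i> * pairing \<nu> (P *v \<nu>) + 2 * pi * \<i> * pairing \<nu> (tilde z + 0))"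
    unfolding quad lin by (simp only: add_0_right) (simp add: algebra_simps)
  finally show ?thesis .
qed

text \<open>Absolute convergence of the four-dimensional series justifies the reindexing and both
  iterated summations; summability of the slices with fixed \<open>e\<close> is inherited from it.
  For fixed \<open>e\<close> each term is a product of a factor in \<open>m\<close> and a factor in
  \<open>n\<close>, so the double series becomes a product.\<close>

lemma theta_prym_reduction:
  assumes \<Omega>: "siegel_upper_half \<Omega>" "prym_reduction \<Omega> P"
  shows "theta z \<Omega> = c_coeff \<Omega> P 0 (- z) * theta (tilde z) P +
    c_coeff \<Omega> P 1 (- z) * theta_char (matrix_inv Delta *v eps 1) 0 (tilde z) P"
proof -
  let ?f = "\<lambda>l::int^4. let v = (\<chi> j. of_int (l$j)) in
    exp (pi * \<i> * pairing v (\<Omega> *v v) + 2 * pi * \<i> * pairing v z)"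
  let ?s = "\<lambda>(e, m, n). prym_shift e m n"
  define C where "C e m = (let v = vector [of_int m, 0, 0, of_int (e - m)]; d = matrix_inv Delta *v eps e in
        exp (pi * \<i> * pairing v (\<Omega> *v v) + pi * \<i> * pairing (eps e) (tilde (- z))
             - 2 * pi * \<i> * pairing v (- z) - pi * \<i> * pairing d (P *v d)))" for e m :: int
  define T where "T e n = (let v = (\<chi> j. of_int (n$j)) + matrix_inv Delta *v eps e in
        exp (pi * \<i> * pairing v (P *v v) + 2 * pi * \<i> * pairing v (tilde z + 0)))" for e and n :: "int^3"
  have "?f summable_on UNIV"
    by (rule abs_summable_summable[OF theta_terms_abs_summable]) fact
  then have s: "(\<lambda>p. ?f (?s p)) summable_on {0, 1} \<times> UNIV"
    using summable_on_reindex_bij_betw[OF bij_betw_prym_shift, of ?f] by blast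
  have fCT: "?f (?s (e, m, n)) = C e m * T e n" for e m n
    unfolding C_def T_def Let_def matrix_inv_Delta_eps prod.case
    by (subst theta_term_prym_shift[OF \<Omega>(2)]) (rule exp_add)
  have "theta z \<Omega> = infsum ?f UNIV"
    by (simp add: theta_def theta_char_def Let_def)
  also have "\<dots> = infsum (\<lambda>p. ?f (?s p)) ({0, 1} \<times> UNIV)"
    by (rule infsum_reindex_bij_betw[OF bij_betw_prym_shift, symmetric])
  also have "\<dots> = infsum (\<lambda>(e, q). ?f (?s (e, q))) ({0, 1} \<times> UNIV)"
    by (rule infsum_cong) auto
  also have "\<dots> = infsum (\<lambda>e. infsum (\<lambda>q. ?f (?s (e, q))) UNIV) {0, 1}"
    by (rule infsum_Sigma'_banach[symmetric]) (use s in \<open>simp add: case_prod_unfold\<close>)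
  also have "\<dots> = (\<Sum>e\<in>{0, 1}. infsum (\<lambda>q. ?f (?s (e, q))) UNIV)"
    by simp
  also have "\<dots> = (\<Sum>e\<in>{0, 1}. infsum (C e) UNIV * infsum (T e) UNIV)"
  proof (rule sum.cong)
    fix e :: int
    assume "e \<in> {0, 1}"
    then have "(\<lambda>p. ?f (?s p)) summable_on Pair e ` UNIV"
      by (intro summable_on_subset_banach[OF s]) auto
    then have se: "(\<lambda>q. ?f (?s (e, q))) summable_on UNIV \<times> UNIV"
      by (subst (asm) summable_on_reindex) (auto simp: inj_on_def o_def)
    have "infsum (\<lambda>q. ?f (?s (e, q))) UNIV = infsum (\<lambda>(m, n). ?f (?s (e, m, n))) (UNIV \<times> UNIV)"
      by (rule infsum_cong_neutral) auto
    also have "\<dots> = infsum (\<lambda>m. infsum (\<lambda>n. ?f (?s (e, m, n))) UNIV) UNIV"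
      by (rule infsum_Sigma'_banach[symmetric]) (use se in \<open>simp add: case_prod_unfold\<close>)
    also have "\<dots> = infsum (\<lambda>m. C e m * infsum (T e) UNIV) UNIV"
      unfolding fCT by (simp add: infsum_cmult_right')
    also have "\<dots> = infsum (C e) UNIV * infsum (T e) UNIV"
      by (rule infsum_cmult_left')
    finally show "infsum (\<lambda>q. ?f (?s (e, q))) UNIV = infsum (C e) UNIV * infsum (T e) UNIV" .
  qed simp
  also have "\<dots> = infsum (C 0) UNIV * infsum (T 0) UNIV + infsum (C 1) UNIV * infsum (T 1) UNIV"
    by simp
  finally have "theta z \<Omega> = infsum (C 0) UNIV * infsum (T 0) UNIV + infsum (C 1) UNIV * infsum (T 1) UNIV" .
  moreover have "infsum (C e) UNIV = c_coeff \<Omega> P e (- z)" for e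
    unfolding c_coeff_def by (rule infsum_cong) (rule C_def)
  moreover have "infsum (T e) UNIV = theta_char (matrix_inv Delta *v eps e) 0 (tilde z) P" for e
    unfolding theta_char_def by (rule infsum_cong) (rule T_def)
  \<comment> \<open>For \<open>e = 0\<close> the characteristic vanishes and the second factor is
    the plain theta function.\<close>
  moreover have "eps 0 = 0"
    by (simp add: eps_def vec_eq_iff forall_3)
  ultimately show ?thesis
    by (simp add: theta_def)
qed

lemma tilde_line:
  "tilde (s *s vector [U1, U2, U3, U1] + w) = s *s vector [2 * U1, U2, U3] + tilde w"
  by (simp add: tilde_def vec_eq_iff forall_3)

text \<open>The two terms linear in \<gamma> combine to pi i (e - 2 m) times the difference of the
  first and last entry of \<gamma>, and a vector with equal first and last entries does not change
  this difference.\<close>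

lemma c_coeff_prym_invariant:
  "c_coeff \<Omega> P e (- (s *s vector [U1, U2, U3, U1] + w)) = c_coeff \<Omega> P e (- w)"
proof -
  let ?U = "s *s vector [U1, U2, U3, U1] :: complex^4"
  have *: "a + pi * \<i> * pairing (eps e) (tilde (- (?U + w))) - 2 * pi * \<i> * pairing v (- (?U + w)) - b
      = a + pi * \<i> * pairing (eps e) (tilde (- w)) - 2 * pi * \<i> * pairing v (- w) - b"
    if "v = vector [of_int m, 0, 0, of_int (e - m)]" for a b v m
    unfolding that by (simp add: pairing_def tilde_def eps_def sum_3 sum_4) (simp add: algebra_simps)
  show ?thesis
    unfolding c_coeff_def Let_def *[OF refl] ..
qed

lemma theta_prym_line:
  assumes "siegel_upper_half \<Omega>" "prym_reduction \<Omega> P"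
  shows "theta (s *s vector [U1, U2, U3, U1] + w) \<Omega> =
    c_coeff \<Omega> P 0 (- w) * theta (s *s vector [2 * U1, U2, U3] + tilde w) P +
    c_coeff \<Omega> P 1 (- w) *
      theta_char (matrix_inv Delta *v eps 1) 0 (s *s vector [2 * U1, U2, U3] + tilde w) P"
  unfolding theta_prym_reduction[OF assms] tilde_line c_coeff_prym_invariant ..

section \<open>Integration of differentials along paths\<close>

text \<open>The choice of the chart \<open>d\<close> is immaterial: see \<open>pullback_eq\<close> below.\<close>

definition pullback ::
  "'p chart set \<Rightarrow> ('p \<Rightarrow> 'p) \<Rightarrow> 'p differential \<Rightarrow> 'p differential" where
  "pullback \<A> \<sigma> \<eta> c z =
     (let d = SOME d. d \<in> \<A> \<and> \<sigma> (inv_into (fst c) (snd c) z) \<in> fst d;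
          T = snd d \<circ> \<sigma> \<circ> inv_into (fst c) (snd c)
      in \<eta> d (T z) * deriv T z)"

text \<open>A universal counterpart of the existential condition in
  \<open>has_path_integral\<close>: the increments of \<open>f\<close> agree near each parameter
  with those of every local primitive in every chart. In this form two primitives along the same
  path can be compared in a common chart. Only increments occur, so additive constants do not
  matter.\<close>

definition primitive_along ::
  "'p chart set \<Rightarrow> 'p differential \<Rightarrow> (real \<Rightarrow> 'p) \<Rightarrow> (real \<Rightarrow> complex) \<Rightarrow> bool" where
  "primitive_along \<A> \<eta> g f \<longleftrightarrow>
     (\<forall>t\<in>{0..1}. \<forall>c\<in>\<A>. \<forall>G W. g t \<in> fst c \<and> open W \<and> W \<subseteq> snd c ` fst c \<and> snd c (g t) \<in> W \<and>
        (\<forall>z\<in>W. (G has_field_derivative \<eta> c z) (at z)) \<longrightarrow>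
        (\<forall>\<^sub>F s in at t within {0..1}. f s - f t = G (snd c (g s)) - G (snd c (g t))))"

text \<open>Used because \<open>simplex_map\<close> restricts to the standard simplex: the path of
  an image simplex agrees with the composed path on the unit interval only.\<close>

lemma has_path_integral_cong:
  assumes I: "has_path_integral \<A> \<eta> g I" and eq: "\<And>t. t \<in> {0..1} \<Longrightarrow> g t = h t"
  shows "has_path_integral \<A> \<eta> h I"
proof -
  have *: "(\<forall>s\<in>{0..1}. \<bar>s - t\<bar> < \<delta> \<longrightarrow> g s \<in> U \<and> \<phi> (g s) \<in> W \<and> f s = G (\<phi> (g s))) \<longleftrightarrow>
      (\<forall>s\<in>{0..1}. \<bar>s - t\<bar> < \<delta> \<longrightarrow> h s \<in> U \<and> \<phi> (h s) \<in> W \<and> f s = G (\<phi> (h s)))"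
    for t \<delta> U W and \<phi> :: "'a \<Rightarrow> complex" and f and G :: "complex \<Rightarrow> complex"
    using eq by auto
  show ?thesis
    using I unfolding has_path_integral_def * .
qed

lemma eventually_pathin_openin:
  assumes "pathin X g" "openin X V" "t \<in> {0..1}" "g t \<in> V"
  shows "\<forall>\<^sub>F s in at t within {0..1}. g s \<in> V"
proof -
  have "openin (top_of_set {0..1}) {s \<in> {0..1}. g s \<in> V}"
    using assms(1,2) openin_continuous_map_preimage unfolding pathin_def by fastforce
  then obtain T where "open T" "{s \<in> {0..1}. g s \<in> V} = {0..1} \<inter> T"
    by (auto simp: openin_open)
  then show ?thesis
    using assms(3,4) unfolding eventually_at_topological by blast
qed

section \<open>Charts, local primitives and integration along paths\<close>

locale charted_surface =
  fixes X :: "'p topology" and \<A> :: "'p chart set"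
  assumes surface: "riemann_surface X \<A>"
begin

lemma chart_at:
  assumes "p \<in> topspace X"
  obtains c where "c \<in> \<A>" "p \<in> fst c"
proof -
  have "p \<in> (\<Union>(U, \<phi>)\<in>\<A>. U)"
    using assms surface unfolding riemann_surface_def by blast
  then show ?thesis
    using that by auto
qed

context
  fixes c :: "'p chart"
  assumes c: "c \<in> \<A>"
begin

lemma openin_chart: "openin X (fst c)" and open_chart_image: "open (snd c ` fst c)"
  and homeomorphic_chart:
    "homeomorphic_map (subtopology X (fst c)) (top_of_set (snd c ` fst c)) (snd c)"
proof -
  have "case c of (U, \<phi>) \<Rightarrow> openin X U \<and> open (\<phi> ` U) \<and>
        homeomorphic_map (subtopology X U) (top_of_set (\<phi> ` U)) \<phi>"
    using surface c unfolding riemann_surface_def by blast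
  then show "openin X (fst c)" "open (snd c ` fst c)"
    "homeomorphic_map (subtopology X (fst c)) (top_of_set (snd c ` fst c)) (snd c)"
    by (simp_all add: case_prod_unfold)
qed

lemma chart_subset: "fst c \<subseteq> topspace X"
  by (rule openin_subset[OF openin_chart])

lemma inj_on_chart: "inj_on (snd c) (fst c)"
  using homeomorphic_imp_injective_map[OF homeomorphic_chart] chart_subset
  by (simp add: Int_absorb1)

lemma chart_inverse: "p \<in> fst c \<Longrightarrow> inv_into (fst c) (snd c) (snd c p) = p"
  by (rule inv_into_f_f[OF inj_on_chart])

lemma open_chart_image_openin:
  assumes "openin X V" "V \<subseteq> fst c"
  shows "open (snd c ` V)"
proof -
  have "openin (subtopology X (fst c)) V"
    using assms by (simp add: openin_open_subtopology openin_chart)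
  then have "openin (top_of_set (snd c ` fst c)) (snd c ` V)"
    using homeomorphic_imp_open_map[OF homeomorphic_chart] by (auto simp: open_map_def)
  then show ?thesis
    using open_chart_image openin_open_trans by blast
qed

lemma openin_chart_preimage:
  assumes "open W"
  shows "openin X {p \<in> fst c. snd c p \<in> W}"
proof -
  have "continuous_map (subtopology X (fst c)) euclidean (snd c)"
    using homeomorphic_imp_continuous_map[OF homeomorphic_chart] continuous_map_in_subtopology by blast
  then have "openin (subtopology X (fst c)) {p \<in> topspace (subtopology X (fst c)). snd c p \<in> W}"
    using assms by (intro openin_continuous_map_preimage) auto
  then show ?thesis
    using chart_subset openin_trans_full[OF _ openin_chart] by (simp add: Int_absorb1)
qed

end

lemma open_chart_overlap: "c \<in> \<A> \<Longrightarrow> d \<in> \<A> \<Longrightarrow> open (snd c ` (fst c \<inter> fst d))"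
  by (intro open_chart_image_openin openin_Int openin_chart) auto

lemma transition_apply: "c \<in> \<A> \<Longrightarrow> p \<in> fst c \<Longrightarrow> transition c d (snd c p) = snd d p"
  by (simp add: transition_def chart_inverse)

lemma transition_has_field_derivative:
  assumes "c \<in> \<A>" "d \<in> \<A>" "z \<in> snd c ` (fst c \<inter> fst d)"
  shows "(transition c d has_field_derivative deriv (transition c d) z) (at z)"
proof -
  have "transition c d holomorphic_on snd c ` (fst c \<inter> fst d)"
    using surface assms(1,2) unfolding riemann_surface_def by blast
  then show ?thesis
    using assms open_chart_overlap holomorphic_derivI by blast
qed

lemma differential_transition:
  assumes "holomorphic_differential \<A> \<eta>" "c \<in> \<A>" "d \<in> \<A>" "z \<in> snd c ` (fst c \<inter> fst d)"
  shows "\<eta> c z = \<eta> d (transition c d z) * deriv (transition c d) z"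
  using assms unfolding holomorphic_differential_def by blast

lemma local_primitive:
  assumes "holomorphic_differential \<A> \<eta>" "c \<in> \<A>" "open W" "W \<subseteq> snd c ` fst c" "convex W"
  obtains G where "\<And>z. z \<in> W \<Longrightarrow> (G has_field_derivative \<eta> c z) (at z)"
proof -
  have "\<eta> c holomorphic_on W"
    using assms unfolding holomorphic_differential_def by (meson holomorphic_on_subset)
  then obtain G where "\<And>z. z \<in> W \<Longrightarrow> (G has_field_derivative \<eta> c z) (at z within W)"
    using holomorphic_convex_primitive'[OF \<open>convex W\<close> \<open>open W\<close>] by blast
  then have "(G has_field_derivative \<eta> c z) (at z)" if "z \<in> W" for z
    using that at_within_open[OF that \<open>open W\<close>] by metis
  then show ?thesis
    by (rule that)
qed

lemma chart_ball:
  assumes "c \<in> \<A>" "p \<in> fst c"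
  obtains r where "0 < r" "ball (snd c p) r \<subseteq> snd c ` fst c"
  using assms open_chart_image[of c] that by (meson imageI openE)

text \<open>One chart and one local primitive per parameter suffice, with equality of increments
  near it; continuity of the path keeps it inside the domain of the primitive.\<close>

lemma has_path_integralI:
  assumes g: "pathin X g" and I: "I = f 1 - f 0"
    and "\<And>t. t \<in> {0..1} \<Longrightarrow> \<exists>c\<in>\<A>. \<exists>G W. g t \<in> fst c \<and> open W \<and> W \<subseteq> snd c ` fst c \<and>
        snd c (g t) \<in> W \<and> (\<forall>z\<in>W. (G has_field_derivative \<eta> c z) (at z)) \<and>
        (\<forall>\<^sub>F s in at t within {0..1}. f s - f t = G (snd c (g s)) - G (snd c (g t)))"
  shows "has_path_integral \<A> \<eta> g I"
  unfolding has_path_integral_def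
proof (intro exI[of _ f] conjI I ballI)
  fix t :: real
  assume t: "t \<in> {0..1}"
  then obtain c G W where c: "c \<in> \<A>" and W: "g t \<in> fst c" "open W" "W \<subseteq> snd c ` fst c" "snd c (g t) \<in> W"
    and G: "\<forall>z\<in>W. (G has_field_derivative \<eta> c z) (at z)"
    and f: "\<forall>\<^sub>F s in at t within {0..1}. f s - f t = G (snd c (g s)) - G (snd c (g t))"
    using assms(3) by meson
  have "\<forall>\<^sub>F s in at t within {0..1}. g s \<in> {p \<in> fst c. snd c p \<in> W}"
    using c W t by (intro eventually_pathin_openin[OF g] openin_chart_preimage) auto
  with f have "\<forall>\<^sub>F s in at t within {0..1}. g s \<in> fst c \<and> snd c (g s) \<in> W \<and>
      f s - f t = G (snd c (g s)) - G (snd c (g t))"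
    by eventually_elim auto
  then obtain \<delta> where \<delta>: "0 < \<delta>" "\<And>s. s \<in> {0..1} \<Longrightarrow> s \<noteq> t \<Longrightarrow> dist s t < \<delta> \<Longrightarrow> g s \<in> fst c \<and> snd c (g s) \<in> W \<and>
      f s - f t = G (snd c (g s)) - G (snd c (g t))"
    unfolding eventually_at by auto
  \<comment> \<open>The shift makes the primitive take the value \<open>f t\<close> at the base
    point, turning equality of increments into equality of values.\<close>
  let ?G = "\<lambda>z. G z + (f t - G (snd c (g t)))"
  have "(?G has_field_derivative \<eta> c z) (at z)" if "z \<in> W" for z
    using G that by (auto intro!: derivative_eq_intros)
  moreover have "g s \<in> fst c \<and> snd c (g s) \<in> W \<and> f s = ?G (snd c (g s))"
    if "s \<in> {0..1}" "\<bar>s - t\<bar> < \<delta>" for s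
    using \<delta>(2)[of s] that W by (cases "s = t") (auto simp: dist_real_def algebra_simps)
  ultimately show "\<exists>(U, \<phi>)\<in>\<A>. \<exists>G W \<delta>. open W \<and> W \<subseteq> \<phi> ` U \<and> 0 < \<delta> \<and>
      (\<forall>z\<in>W. (G has_field_derivative \<eta> (U, \<phi>) z) (at z)) \<and>
      (\<forall>s\<in>{0..1}. \<bar>s - t\<bar> < \<delta> \<longrightarrow> g s \<in> U \<and> \<phi> (g s) \<in> W \<and> f s = G (\<phi> (g s)))"
    using W \<delta>(1) c by (intro bexI[of _ c]) (auto simp: case_prod_unfold intro!: exI[of _ ?G] exI[of _ W] exI[of _ \<delta>])
qed

text \<open>The witness of the integral provides some chart \<open>d\<close> and primitive G'. By
  the transformation law of \<eta>, any primitive G in another chart \<open>c\<close> differs from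
  G' composed with the transition by a function with derivative zero, hence by a constant on a
  ball.\<close>

lemma has_path_integralE:
  assumes \<eta>: "holomorphic_differential \<A> \<eta>" and g: "pathin X g" and I: "has_path_integral \<A> \<eta> g I"
  obtains f where "I = f 1 - f 0" "primitive_along \<A> \<eta> g f"
proof -
  obtain f where f: "I = f 1 - f 0"
    "\<forall>t\<in>{0..1}. \<exists>(U, \<phi>)\<in>\<A>. \<exists>G W \<delta>. open W \<and> W \<subseteq> \<phi> ` U \<and> 0 < \<delta> \<and>
           (\<forall>z\<in>W. (G has_field_derivative \<eta> (U, \<phi>) z) (at z)) \<and>
           (\<forall>s\<in>{0..1}. \<bar>s - t\<bar> < \<delta> \<longrightarrow> g s \<in> U \<and> \<phi> (g s) \<in> W \<and> f s = G (\<phi> (g s)))"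
    using I unfolding has_path_integral_def by blast
  have "primitive_along \<A> \<eta> g f"
    unfolding primitive_along_def
  proof (intro ballI allI impI, elim conjE)
    fix t c G W
    assume t: "t \<in> {0..1}" and c: "c \<in> \<A>" and W: "g t \<in> fst c" "open W" "W \<subseteq> snd c ` fst c" "snd c (g t) \<in> W"
      and G: "\<forall>z\<in>W. (G has_field_derivative \<eta> c z) (at z)"
    obtain d G' W' \<delta> where d: "d \<in> \<A>" and W': "open W'" "W' \<subseteq> snd d ` fst d" "0 < \<delta>"
      and G': "\<forall>z\<in>W'. (G' has_field_derivative \<eta> d z) (at z)"
      and \<delta>: "\<forall>s\<in>{0..1}. \<bar>s - t\<bar> < \<delta> \<longrightarrow> g s \<in> fst d \<and> snd d (g s) \<in> W' \<and> f s = G' (snd d (g s))"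
      using bspec[OF f(2) t] unfolding case_prod_unfold prod.collapse
      by (elim bexE exE conjE) (rule that)
    let ?T = "transition c d"
    have gt: "g t \<in> fst d" "snd d (g t) \<in> W'"
      using \<delta> t W'(3) by auto
    \<comment> \<open>Where both charts and both primitives are available; a ball in its image in
      \<open>c\<close> supplies the convexity needed for constancy.\<close>
    define N where "N = {p \<in> fst c. snd c p \<in> W} \<inter> {p \<in> fst d. snd d p \<in> W'}"
    have N: "openin X N" "g t \<in> N" "N \<subseteq> fst c \<inter> fst d"
      using openin_chart_preimage[OF c W(2)] openin_chart_preimage[OF d W'(1)] W gt
      by (auto simp: N_def)
    then obtain r where r: "0 < r" "ball (snd c (g t)) r \<subseteq> snd c ` N"
      using open_chart_image_openin[OF c, of N] unfolding open_contains_ball by blast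
    have zero: "((\<lambda>z. G z - G' (?T z)) has_field_derivative 0) (at z)" if zr: "z \<in> ball (snd c (g t)) r" for z
    proof -
      obtain p where p: "p \<in> N" "z = snd c p"
        using r(2) zr by blast
      have Tz: "?T z = snd d p"
        using p N(3) transition_apply[OF c, of p d] by auto
      have z: "z \<in> snd c ` (fst c \<inter> fst d)"
        using p N(3) by auto
      have "(G' has_field_derivative \<eta> d (?T z)) (at (?T z))"
        using G' p Tz by (simp add: N_def)
      from DERIV_chain2[OF this transition_has_field_derivative[OF c d z]]
      have "((\<lambda>z. G' (?T z)) has_field_derivative \<eta> c z) (at z)"
        by (simp add: differential_transition[OF \<eta> c d z])
      moreover have "(G has_field_derivative \<eta> c z) (at z)"
        using G p by (simp add: N_def)
      ultimately show ?thesis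
        using DERIV_diff by fastforce
    qed
    have const: "G (snd c p) - G' (snd d p) = G (snd c (g t)) - G' (snd d (g t))"
      if "p \<in> fst c" "snd c p \<in> ball (snd c (g t)) r" for p
    proof -
      have "\<exists>k. \<forall>z\<in>ball (snd c (g t)) r. G z - G' (?T z) = k"
        using zero by (intro has_field_derivative_zero_constant convex_ball) (rule has_field_derivative_at_within)
      then have "G (snd c p) - G' (?T (snd c p)) = G (snd c (g t)) - G' (?T (snd c (g t)))"
        using that(2) r(1) by fastforce
      then show ?thesis
        using transition_apply[OF c that(1), of d] transition_apply[OF c W(1), of d] by simp
    qed
    have ft: "f t = G' (snd d (g t))"
      using \<delta> t W'(3) by simp
    have "\<forall>\<^sub>F s in at t within {0..1}. g s \<in> {p \<in> fst c. snd c p \<in> ball (snd c (g t)) r}"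
      using c W t r(1) by (intro eventually_pathin_openin[OF g] openin_chart_preimage) auto
    moreover have "\<forall>\<^sub>F s in at t within {0..1}. f s = G' (snd d (g s))"
      unfolding eventually_at using \<delta> W'(3) by (auto simp: dist_real_def)
    ultimately show "\<forall>\<^sub>F s in at t within {0..1}. f s - f t = G (snd c (g s)) - G (snd c (g t))"
    proof eventually_elim
      case (elim s)
      then show ?case
        using const[of "g s"] ft by (auto simp: algebra_simps)
    qed
  qed
  then show ?thesis
    using that f(1) by blast
qed

lemma pathin_chart:
  assumes "pathin X g" "t \<in> {0..1}"
  obtains c where "c \<in> \<A>" "g t \<in> fst c"
proof -
  have "g t \<in> topspace X"
    using assms unfolding pathin_def continuous_map_def by auto
  then show ?thesis
    using chart_at that by blast
qed

text \<open>Both primitives have the increments of one and the same local primitive, so their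
  difference is locally constant on the connected unit interval.\<close>

lemma has_path_integral_unique:
  assumes \<eta>: "holomorphic_differential \<A> \<eta>" and g: "pathin X g"
    and "has_path_integral \<A> \<eta> g I" "has_path_integral \<A> \<eta> g J"
  shows "I = J"
proof -
  obtain f h where f: "I = f 1 - f 0" "primitive_along \<A> \<eta> g f"
    and h: "J = h 1 - h 0" "primitive_along \<A> \<eta> g h"
    using assms has_path_integralE by metis
  have "f 0 - h 0 = f 1 - h 1"
  proof (rule connected_local_const[where A = "{0..1}" and f = "\<lambda>t. f t - h t"])
    show "\<forall>t\<in>{0..1}. \<forall>\<^sub>F s in at t within {0..1}. f t - h t = f s - h s"
    proof
      fix t :: real
      assume t: "t \<in> {0..1}"
      obtain c where c: "c \<in> \<A>" "g t \<in> fst c"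
        using pathin_chart[OF g t] .
      then obtain r where r: "0 < r" "ball (snd c (g t)) r \<subseteq> snd c ` fst c"
        by (rule chart_ball)
      obtain G where "\<And>z. z \<in> ball (snd c (g t)) r \<Longrightarrow> (G has_field_derivative \<eta> c z) (at z)"
        using local_primitive[OF \<eta> c(1) open_ball r(2) convex_ball] by blast
      then have *: "g t \<in> fst c \<and> open (ball (snd c (g t)) r) \<and> ball (snd c (g t)) r \<subseteq> snd c ` fst c \<and>
          snd c (g t) \<in> ball (snd c (g t)) r \<and> (\<forall>z\<in>ball (snd c (g t)) r. (G has_field_derivative \<eta> c z) (at z))"
        using c r by simp
      from f(2) t c(1) * have "\<forall>\<^sub>F s in at t within {0..1}. f s - f t = G (snd c (g s)) - G (snd c (g t))"
        unfolding primitive_along_def by blast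
      moreover from h(2) t c(1) * have "\<forall>\<^sub>F s in at t within {0..1}. h s - h t = G (snd c (g s)) - G (snd c (g t))"
        unfolding primitive_along_def by blast
      ultimately show "\<forall>\<^sub>F s in at t within {0..1}. f t - h t = f s - h s"
      proof eventually_elim
        case (elim s)
        then have "f s - f t = h s - h t"
          by simp
        then show ?case
          by (simp add: algebra_simps)
      qed
    qed
  qed auto
  then show ?thesis
    by (simp add: f(1) h(1) algebra_simps)
qed

lemma holomorphic_differential_sum:
  assumes "\<And>k. k \<in> K \<Longrightarrow> holomorphic_differential \<A> (\<eta> k)"
  shows "holomorphic_differential \<A> (\<lambda>c z. \<Sum>k\<in>K. C k * \<eta> k c z)"
  unfolding holomorphic_differential_def
proof (intro conjI ballI)
  show "(\<lambda>z. \<Sum>k\<in>K. C k * \<eta> k c z) holomorphic_on snd c ` fst c" if "c \<in> \<A>" for c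
    using assms that unfolding holomorphic_differential_def by (intro holomorphic_intros) auto
  show "(\<Sum>k\<in>K. C k * \<eta> k c z) =
      (\<Sum>k\<in>K. C k * \<eta> k d (transition c d z)) * deriv (transition c d) z"
    if "c \<in> \<A>" "d \<in> \<A>" "z \<in> snd c ` (fst c \<inter> fst d)" for c d z
    unfolding sum_distrib_right
    by (intro sum.cong refl) (simp add: differential_transition[OF assms that])
qed

lemma has_path_integral_sum:
  assumes \<eta>: "\<And>k. k \<in> K \<Longrightarrow> holomorphic_differential \<A> (\<eta> k)" and g: "pathin X g"
    and I: "\<And>k. k \<in> K \<Longrightarrow> has_path_integral \<A> (\<eta> k) g (I k)"
  shows "has_path_integral \<A> (\<lambda>c z. \<Sum>k\<in>K. C k * \<eta> k c z) g (\<Sum>k\<in>K. C k * I k)"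
proof (cases "finite K")
  case K: True
  have "\<forall>k\<in>K. \<exists>f. I k = f 1 - f 0 \<and> primitive_along \<A> (\<eta> k) g f"
    using has_path_integralE[OF \<eta> g I] by metis
  then obtain f where f: "\<And>k. k \<in> K \<Longrightarrow> I k = f k 1 - f k 0"
    "\<And>k. k \<in> K \<Longrightarrow> primitive_along \<A> (\<eta> k) g (f k)"
    by metis
  show ?thesis
  proof (rule has_path_integralI[OF g, where f = "\<lambda>s. \<Sum>k\<in>K. C k * f k s"])
    show "(\<Sum>k\<in>K. C k * I k) = (\<Sum>k\<in>K. C k * f k 1) - (\<Sum>k\<in>K. C k * f k 0)"
      by (simp add: f(1) right_diff_distrib sum_subtractf)
    fix t :: real
    assume t: "t \<in> {0..1}"
    obtain c where c: "c \<in> \<A>" "g t \<in> fst c"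
      using pathin_chart[OF g t] .
    then obtain r where r: "0 < r" "ball (snd c (g t)) r \<subseteq> snd c ` fst c"
      by (rule chart_ball)
    let ?W = "ball (snd c (g t)) r"
    have "\<forall>k\<in>K. \<exists>G. \<forall>z\<in>?W. (G has_field_derivative \<eta> k c z) (at z)"
      using local_primitive[OF \<eta> c(1) open_ball r(2) convex_ball] by meson
    then obtain G where G: "\<And>k z. k \<in> K \<Longrightarrow> z \<in> ?W \<Longrightarrow> (G k has_field_derivative \<eta> k c z) (at z)"
      by metis
    have "\<forall>\<^sub>F s in at t within {0..1}. f k s - f k t = G k (snd c (g s)) - G k (snd c (g t))"
      if k: "k \<in> K" for k
    proof -
      have "g t \<in> fst c \<and> open ?W \<and> ?W \<subseteq> snd c ` fst c \<and> snd c (g t) \<in> ?W \<and>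
          (\<forall>z\<in>?W. (G k has_field_derivative \<eta> k c z) (at z))"
        using c r G k by simp
      then show ?thesis
        using f(2)[OF k] t c(1) unfolding primitive_along_def by blast
    qed
    then have "\<forall>\<^sub>F s in at t within {0..1}. \<forall>k\<in>K. f k s - f k t = G k (snd c (g s)) - G k (snd c (g t))"
      using K by (simp add: eventually_ball_finite)
    then have "\<forall>\<^sub>F s in at t within {0..1}. (\<Sum>k\<in>K. C k * f k s) - (\<Sum>k\<in>K. C k * f k t) =
        (\<Sum>k\<in>K. C k * G k (snd c (g s))) - (\<Sum>k\<in>K. C k * G k (snd c (g t)))"
      by eventually_elim (simp flip: sum_subtractf right_diff_distrib)
    moreover have "((\<lambda>z. \<Sum>k\<in>K. C k * G k z) has_field_derivative (\<Sum>k\<in>K. C k * \<eta> k c z)) (at z)"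
      if "z \<in> ?W" for z
      using G that by (intro DERIV_sum DERIV_cmult)
    ultimately show "\<exists>c\<in>\<A>. \<exists>G W. g t \<in> fst c \<and> open W \<and> W \<subseteq> snd c ` fst c \<and> snd c (g t) \<in> W \<and>
        (\<forall>z\<in>W. (G has_field_derivative (\<Sum>k\<in>K. C k * \<eta> k c z)) (at z)) \<and>
        (\<forall>\<^sub>F s in at t within {0..1}. (\<Sum>k\<in>K. C k * f k s) - (\<Sum>k\<in>K. C k * f k t) =
          G (snd c (g s)) - G (snd c (g t)))"
      using c r by (intro bexI[of _ c] exI[of _ "\<lambda>z. \<Sum>k\<in>K. C k * G k z"] exI[of _ ?W]) auto
  qed
next
  \<comment> \<open>Sums over an infinite index set are 0 by convention; what remains is the
    integral of the zero differential.\<close>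
  case False
  show ?thesis
  proof (rule has_path_integralI[OF g, where f = "\<lambda>s. 0"])
    fix t :: real
    assume t: "t \<in> {0..1}"
    obtain c where c: "c \<in> \<A>" "g t \<in> fst c"
      using pathin_chart[OF g t] .
    then show "\<exists>c\<in>\<A>. \<exists>G W. g t \<in> fst c \<and> open W \<and> W \<subseteq> snd c ` fst c \<and> snd c (g t) \<in> W \<and>
        (\<forall>z\<in>W. (G has_field_derivative (\<Sum>k\<in>K. C k * \<eta> k c z)) (at z)) \<and>
        (\<forall>\<^sub>F s in at t within {0..1}. 0 - 0 = G (snd c (g s)) - G (snd c (g t)))"
      using False open_chart_image[OF c(1)]
      by (intro bexI[of _ c] exI[of _ "\<lambda>z. 0"] exI[of _ "snd c ` fst c"]) auto
  qed (use False in simp)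
qed

end

section \<open>Pullback of differentials\<close>

context charted_surface
begin

context
  fixes \<sigma> :: "'p \<Rightarrow> 'p"
  assumes \<sigma>: "holomorphic_self_map X \<A> \<sigma>"
begin

abbreviation (input) local_form :: "'p chart \<Rightarrow> 'p chart \<Rightarrow> complex \<Rightarrow> complex" where
  "local_form c d \<equiv> snd d \<circ> \<sigma> \<circ> inv_into (fst c) (snd c)"

lemma openin_local_form_domain:
  assumes "c \<in> \<A>" "d \<in> \<A>"
  shows "openin X (fst c \<inter> \<sigma> -` fst d)"
proof -
  have "openin X {p \<in> topspace X. \<sigma> p \<in> fst d}"
    using \<sigma> assms openin_chart unfolding holomorphic_self_map_def
    by (intro openin_continuous_map_preimage) auto
  moreover have "fst c \<inter> \<sigma> -` fst d = fst c \<inter> {p \<in> topspace X. \<sigma> p \<in> fst d}"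
    using chart_subset[OF assms(1)] by auto
  ultimately show ?thesis
    using openin_Int[OF openin_chart[OF assms(1)]] by simp
qed

lemma local_form_holomorphic:
  assumes "c \<in> \<A>" "d \<in> \<A>"
  shows "local_form c d holomorphic_on snd c ` (fst c \<inter> \<sigma> -` fst d)"
  using \<sigma> assms unfolding holomorphic_self_map_def by fastforce

lemma open_local_form_domain: "c \<in> \<A> \<Longrightarrow> d \<in> \<A> \<Longrightarrow> open (snd c ` (fst c \<inter> \<sigma> -` fst d))"
  using openin_local_form_domain by (intro open_chart_image_openin) auto

lemma local_form_has_field_derivative:
  assumes "c \<in> \<A>" "d \<in> \<A>" "p \<in> fst c" "\<sigma> p \<in> fst d"
  shows "(local_form c d has_field_derivative deriv (local_form c d) (snd c p)) (at (snd c p))"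
  by (rule holomorphic_derivI[OF local_form_holomorphic[OF assms(1,2)] open_local_form_domain[OF assms(1,2)]])
    (use assms in auto)

lemma self_map_chart:
  assumes "p \<in> topspace X"
  obtains d where "d \<in> \<A>" "\<sigma> p \<in> fst d"
proof -
  have "\<sigma> p \<in> topspace X"
    using \<sigma> assms unfolding holomorphic_self_map_def continuous_map_def by auto
  then show ?thesis
    using chart_at that by blast
qed

text \<open>Changing the target chart multiplies the derivative of the local form by the derivative
  of the transition map, exactly the factor by which the coefficient of \<eta> changes.\<close>

lemma pullback_eq:
  assumes \<eta>: "holomorphic_differential \<A> \<eta>"
    and c: "c \<in> \<A>" and d: "d \<in> \<A>" and p: "p \<in> fst c" "\<sigma> p \<in> fst d"
  shows "pullback \<A> \<sigma> \<eta> c (snd c p) = \<eta> d (snd d (\<sigma> p)) * deriv (local_form c d) (snd c p)"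
proof -
  define e where "e = (SOME e. e \<in> \<A> \<and> \<sigma> p \<in> fst e)"
  have e: "e \<in> \<A>" "\<sigma> p \<in> fst e"
    using someI[of "\<lambda>e. e \<in> \<A> \<and> \<sigma> p \<in> fst e" d] d p by (auto simp: e_def)
  have z: "snd d (\<sigma> p) \<in> snd d ` (fst d \<inter> fst e)"
    using p e by auto
  have "(transition d e has_field_derivative deriv (transition d e) (snd d (\<sigma> p))) (at (local_form c d (snd c p)))"
    using transition_has_field_derivative[OF d e(1) z] by (simp add: chart_inverse c p)
  from DERIV_chain[OF this local_form_has_field_derivative[OF c d p]]
  have "(transition d e \<circ> local_form c d has_field_derivative
      deriv (transition d e) (snd d (\<sigma> p)) * deriv (local_form c d) (snd c p)) (at (snd c p))" .
  \<comment> \<open>The two local forms agree only where \<sigma> maps into \<open>d\<close>, an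
    open set around the point, which is enough for the derivative.\<close>
  then have "(local_form c e has_field_derivative
      deriv (transition d e) (snd d (\<sigma> p)) * deriv (local_form c d) (snd c p)) (at (snd c p))"
  proof (rule has_field_derivative_transform_within_open)
    show "open (snd c ` (fst c \<inter> \<sigma> -` fst d))"
      by (rule open_local_form_domain[OF c d])
    show "snd c p \<in> snd c ` (fst c \<inter> \<sigma> -` fst d)"
      using p by auto
    show "(transition d e \<circ> local_form c d) z = local_form c e z" if "z \<in> snd c ` (fst c \<inter> \<sigma> -` fst d)" for z
      using that by (auto simp: chart_inverse c transition_apply d)
  qed
  then have "deriv (local_form c e) (snd c p) =
      deriv (transition d e) (snd d (\<sigma> p)) * deriv (local_form c d) (snd c p)"
    by (rule DERIV_imp_deriv)
  moreover have "pullback \<A> \<sigma> \<eta> c (snd c p) = \<eta> e (snd e (\<sigma> p)) * deriv (local_form c e) (snd c p)"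
    by (simp add: pullback_def chart_inverse c p Let_def e_def)
  moreover have "\<eta> d (snd d (\<sigma> p)) = \<eta> e (snd e (\<sigma> p)) * deriv (transition d e) (snd d (\<sigma> p))"
    using differential_transition[OF \<eta> d e(1) z] by (simp add: transition_apply d p)
  ultimately show ?thesis
    by simp
qed

text \<open>The chart chosen in \<open>pullback\<close> may jump from point to point. Near a given
  point it can be replaced by one fixed chart, where the coefficient is a product of holomorphic
  functions; the transformation law is then the chain rule.\<close>

lemma holomorphic_differential_pullback:
  assumes \<eta>: "holomorphic_differential \<A> \<eta>"
  shows "holomorphic_differential \<A> (pullback \<A> \<sigma> \<eta>)"
  unfolding holomorphic_differential_def
proof (intro conjI ballI)
  fix c
  assume c: "c \<in> \<A>"
  have "pullback \<A> \<sigma> \<eta> c field_differentiable (at (snd c p))" if p: "p \<in> fst c" for p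
  proof -
    obtain d where d: "d \<in> \<A>" "\<sigma> p \<in> fst d"
      using self_map_chart chart_subset[OF c] p by blast
    let ?D = "snd c ` (fst c \<inter> \<sigma> -` fst d)"
    have "\<eta> d holomorphic_on snd d ` fst d"
      using \<eta> d unfolding holomorphic_differential_def by blast
    then have "(\<eta> d \<circ> local_form c d) holomorphic_on ?D"
      using local_form_holomorphic[OF c d(1)]
      by (intro holomorphic_on_compose_gen) (auto simp: chart_inverse c)
    moreover have "deriv (local_form c d) holomorphic_on ?D"
      by (rule holomorphic_deriv[OF local_form_holomorphic[OF c d(1)] open_local_form_domain[OF c d(1)]])
    ultimately have "(\<lambda>z. (\<eta> d \<circ> local_form c d) z * deriv (local_form c d) z) holomorphic_on ?D"
      by (rule holomorphic_on_mult)
    then have "pullback \<A> \<sigma> \<eta> c holomorphic_on ?D"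
      by (rule holomorphic_transform) (auto simp: pullback_eq[OF \<eta> c d(1)] chart_inverse c)
    then show ?thesis
      using open_local_form_domain[OF c d(1)] p d
      by (intro holomorphic_on_imp_differentiable_at) auto
  qed
  then show "pullback \<A> \<sigma> \<eta> c holomorphic_on snd c ` fst c"
    by (auto simp: holomorphic_on_def field_differentiable_at_within)
next
  fix c e z
  assume c: "c \<in> \<A>" and e: "e \<in> \<A>" and "z \<in> snd c ` (fst c \<inter> fst e)"
  then obtain p where p: "p \<in> fst c" "p \<in> fst e" "z = snd c p"
    by auto
  obtain d where d: "d \<in> \<A>" "\<sigma> p \<in> fst d"
    using self_map_chart chart_subset[OF c] p by blast
  have z: "snd c p \<in> snd c ` (fst c \<inter> fst e)"
    using p by auto
  have "(local_form e d has_field_derivative deriv (local_form e d) (snd e p)) (at (transition c e (snd c p)))"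
    using local_form_has_field_derivative[OF e d(1) p(2) d(2)] by (simp add: transition_apply c p)
  from DERIV_chain[OF this transition_has_field_derivative[OF c e z]]
  have "(local_form e d \<circ> transition c e has_field_derivative
      deriv (local_form e d) (snd e p) * deriv (transition c e) (snd c p)) (at (snd c p))" .
  then have "(local_form c d has_field_derivative
      deriv (local_form e d) (snd e p) * deriv (transition c e) (snd c p)) (at (snd c p))"
  proof (rule has_field_derivative_transform_within_open)
    show "(local_form e d \<circ> transition c e) z = local_form c d z" if "z \<in> snd c ` (fst c \<inter> fst e)" for z
      using that by (auto simp: chart_inverse c e transition_apply)
  qed (use open_chart_overlap[OF c e] z in auto)
  then have "deriv (local_form c d) (snd c p) =
      deriv (local_form e d) (snd e p) * deriv (transition c e) (snd c p)"
    by (rule DERIV_imp_deriv)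
  then show "pullback \<A> \<sigma> \<eta> c z =
      pullback \<A> \<sigma> \<eta> e (transition c e z) * deriv (transition c e) z"
    by (simp only: p(3) transition_apply[OF c p(1)] pullback_eq[OF \<eta> c d(1) p(1) d(2)]
        pullback_eq[OF \<eta> e d(1) p(2) d(2)] mult.assoc)
qed

text \<open>The primitive \<open>f\<close> along the image path serves unchanged along
  \<open>g\<close>: a local primitive of \<eta> composed with \<sigma> in charts is a local
  primitive of the pullback.\<close>

lemma has_path_integral_pullback:
  assumes \<eta>: "holomorphic_differential \<A> \<eta>" and g: "pathin X g"
    and I: "has_path_integral \<A> \<eta> (\<sigma> \<circ> g) I"
  shows "has_path_integral \<A> (pullback \<A> \<sigma> \<eta>) g I"
proof -
  have "pathin X (\<sigma> \<circ> g)"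
    using \<sigma> g unfolding holomorphic_self_map_def pathin_def by (auto intro: continuous_map_compose)
  then obtain f where f: "I = f 1 - f 0" "primitive_along \<A> \<eta> (\<sigma> \<circ> g) f"
    using has_path_integralE[OF \<eta> _ I] by blast
  show ?thesis
  proof (rule has_path_integralI[OF g f(1)])
    fix t :: real
    assume t: "t \<in> {0..1}"
    obtain c where c: "c \<in> \<A>" "g t \<in> fst c"
      using pathin_chart[OF g t] .
    obtain d where d: "d \<in> \<A>" "\<sigma> (g t) \<in> fst d"
      using self_map_chart chart_subset c by blast
    obtain r where r: "0 < r" "ball (snd d (\<sigma> (g t))) r \<subseteq> snd d ` fst d"
      using chart_ball[OF d] .
    let ?B = "ball (snd d (\<sigma> (g t))) r" and ?D = "snd c ` (fst c \<inter> \<sigma> -` fst d)"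
    obtain G where G: "\<And>z. z \<in> ?B \<Longrightarrow> (G has_field_derivative \<eta> d z) (at z)"
      using local_primitive[OF \<eta> d(1) open_ball r(2) convex_ball] by blast
    \<comment> \<open>Restricting to the preimage of the ball makes the composite with
      \<open>G\<close> differentiable at every point of \<open>W\<close>.\<close>
    define W where "W = ?D \<inter> local_form c d -` ?B"
    have W: "open W"
      unfolding W_def using holomorphic_on_imp_continuous_on[OF local_form_holomorphic[OF c(1) d(1)]]
        open_local_form_domain[OF c(1) d(1)]
      by (intro continuous_open_preimage) auto
    have "(G \<circ> local_form c d has_field_derivative pullback \<A> \<sigma> \<eta> c z) (at z)" if z: "z \<in> W" for z
    proof -
      obtain p where p: "p \<in> fst c" "\<sigma> p \<in> fst d" "z = snd c p"
        using z by (auto simp: W_def)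
      have "(G has_field_derivative \<eta> d (snd d (\<sigma> p))) (at (local_form c d (snd c p)))"
        using G[of "snd d (\<sigma> p)"] z p by (simp add: W_def chart_inverse c)
      from DERIV_chain[OF this local_form_has_field_derivative[OF c(1) d(1) p(1,2)]]
      show ?thesis
        unfolding p(3) pullback_eq[OF \<eta> c(1) d(1) p(1,2)] .
    qed
    moreover have "snd c (g t) \<in> W"
      using c d r(1) by (auto simp: W_def chart_inverse)
    moreover have "\<forall>\<^sub>F s in at t within {0..1}. f s - f t =
        (G \<circ> local_form c d) (snd c (g s)) - (G \<circ> local_form c d) (snd c (g t))"
    proof -
      have "(\<sigma> \<circ> g) t \<in> fst d \<and> open ?B \<and> ?B \<subseteq> snd d ` fst d \<and> snd d ((\<sigma> \<circ> g) t) \<in> ?B \<and>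
          (\<forall>z\<in>?B. (G has_field_derivative \<eta> d z) (at z))"
        using d r G by simp
      then have "\<forall>\<^sub>F s in at t within {0..1}. f s - f t = G (snd d ((\<sigma> \<circ> g) s)) - G (snd d ((\<sigma> \<circ> g) t))"
        using f(2) t d(1) unfolding primitive_along_def by blast
      moreover have "\<forall>\<^sub>F s in at t within {0..1}. g s \<in> fst c"
        by (rule eventually_pathin_openin[OF g openin_chart t]) (use c in auto)
      ultimately show ?thesis
        by eventually_elim (simp add: chart_inverse c)
    qed
    ultimately show "\<exists>c\<in>\<A>. \<exists>G W. g t \<in> fst c \<and> open W \<and> W \<subseteq> snd c ` fst c \<and> snd c (g t) \<in> W \<and>
        (\<forall>z\<in>W. (G has_field_derivative pullback \<A> \<sigma> \<eta> c z) (at z)) \<and>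
        (\<forall>\<^sub>F s in at t within {0..1}. f s - f t = G (snd c (g s)) - G (snd c (g t)))"
      using c W by (intro bexI[of _ c] exI[of _ "G \<circ> local_form c d"] exI[of _ W]) (auto simp: W_def)
  qed
qed

end

end

section \<open>Periods\<close>

lemma has_path_integral_same_differential:
  assumes "same_differential \<A> \<eta> \<zeta>" and I: "has_path_integral \<A> \<eta> g I"
  shows "has_path_integral \<A> \<zeta> g I"
  unfolding has_path_integral_def
proof -
  obtain f where f: "I = f 1 - f 0"
    "\<forall>t\<in>{0..1}. \<exists>(U, \<phi>)\<in>\<A>. \<exists>G W \<delta>. open W \<and> W \<subseteq> \<phi> ` U \<and> 0 < \<delta> \<and>
           (\<forall>z\<in>W. (G has_field_derivative \<eta> (U, \<phi>) z) (at z)) \<and>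
           (\<forall>s\<in>{0..1}. \<bar>s - t\<bar> < \<delta> \<longrightarrow> g s \<in> U \<and> \<phi> (g s) \<in> W \<and> f s = G (\<phi> (g s)))"
    using I unfolding has_path_integral_def by blast
  have eq: "\<eta> c z = \<zeta> c z" if "c \<in> \<A>" "z \<in> snd c ` fst c" for c z
    using assms(1) that unfolding same_differential_def by blast
  have "\<exists>(U, \<phi>)\<in>\<A>. \<exists>G W \<delta>. open W \<and> W \<subseteq> \<phi> ` U \<and> 0 < \<delta> \<and>
           (\<forall>z\<in>W. (G has_field_derivative \<zeta> (U, \<phi>) z) (at z)) \<and>
           (\<forall>s\<in>{0..1}. \<bar>s - t\<bar> < \<delta> \<longrightarrow> g s \<in> U \<and> \<phi> (g s) \<in> W \<and> f s = G (\<phi> (g s)))"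
    if t: "t \<in> {0..1}" for t
  proof -
    obtain c G W \<delta> where c: "c \<in> \<A>" and W: "open W" "W \<subseteq> snd c ` fst c" "0 < \<delta>"
      and G: "\<forall>z\<in>W. (G has_field_derivative \<eta> c z) (at z)"
      and \<delta>: "\<forall>s\<in>{0..1}. \<bar>s - t\<bar> < \<delta> \<longrightarrow> g s \<in> fst c \<and> snd c (g s) \<in> W \<and> f s = G (snd c (g s))"
      using bspec[OF f(2) t] unfolding case_prod_unfold prod.collapse
      by (elim bexE exE conjE) (rule that)
    have "\<forall>z\<in>W. (G has_field_derivative \<zeta> c z) (at z)"
      using G W(2) eq[OF c] by (metis subsetD)
    then show ?thesis
      unfolding case_prod_unfold prod.collapse using c W \<delta> by meson
  qed
  then show "\<exists>f. I = f 1 - f 0 \<and>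
        (\<forall>t\<in>{0..1}. \<exists>(U, \<phi>)\<in>\<A>. \<exists>G W \<delta>. open W \<and> W \<subseteq> \<phi> ` U \<and> 0 < \<delta> \<and>
           (\<forall>z\<in>W. (G has_field_derivative \<zeta> (U, \<phi>) z) (at z)) \<and>
           (\<forall>s\<in>{0..1}. \<bar>s - t\<bar> < \<delta> \<longrightarrow> g s \<in> U \<and> \<phi> (g s) \<in> W \<and> f s = G (\<phi> (g s))))"
    using f(1) by blast
qed

lemma has_chain_integral_same_differential:
  "same_differential \<A> \<eta> \<zeta> \<Longrightarrow> has_chain_integral \<A> \<eta> c I \<Longrightarrow> has_chain_integral \<A> \<zeta> c I"
  unfolding has_chain_integral_def using has_path_integral_same_differential[of \<A> \<eta> \<zeta>] by blast

lemma has_chain_integral_uminus: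
  assumes "has_chain_integral \<A> \<eta> c I"
  shows "has_chain_integral \<A> \<eta> (- c) (- I)"
proof -
  obtain J where J: "\<forall>f\<in>Poly_Mapping.keys c. has_path_integral \<A> \<eta> (simplex_path f) (J f)"
    and I: "I = (\<Sum>f\<in>Poly_Mapping.keys c. of_int (Poly_Mapping.lookup c f) * J f)"
    using assms unfolding has_chain_integral_def by blast
  show ?thesis
    unfolding has_chain_integral_def
    by (intro exI[of _ J] conjI) (use J in \<open>simp_all add: I sum_negf\<close>)
qed

section \<open>Singular 1-simplices as paths and their images under a map\<close>

lemma simplex_path_point_in_standard_simplex:
  assumes "t \<in> {0..1}"
  shows "(\<lambda>i. if i = 0 then 1 - t else if i = 1 then t else 0) \<in> standard_simplex 1"
  using assms by (auto simp: standard_simplex_def)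

lemma pathin_simplex_path:
  assumes "singular_simplex 1 X f"
  shows "pathin X (simplex_path f)"
proof -
  let ?h = "\<lambda>(t::real) (i::nat). if i = 0 then 1 - t else if i = 1 then t else 0"
  have "continuous_map (top_of_set {0..1}) (powertop_real UNIV) ?h"
    unfolding continuous_map_componentwise_UNIV
  proof
    show "continuous_map (top_of_set {0..1}) euclideanreal (\<lambda>t. ?h t i)" for i
      by (cases "i = 0"; cases "i = 1") (auto intro!: continuous_intros)
  qed
  then have "continuous_map (top_of_set {0..1}) (subtopology (powertop_real UNIV) (standard_simplex 1)) ?h"
    using simplex_path_point_in_standard_simplex by (auto simp: continuous_map_in_subtopology)
  moreover have "continuous_map (subtopology (powertop_real UNIV) (standard_simplex 1)) X f"
    using assms by (simp add: singular_simplex_def)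
  ultimately have "continuous_map (top_of_set {0..1}) X (f \<circ> ?h)"
    by (rule continuous_map_compose)
  then show ?thesis
    by (simp add: pathin_def simplex_path_def[abs_def] o_def)
qed

lemma simplex_path_simplex_map:
  assumes "t \<in> {0..1}"
  shows "simplex_path (simplex_map 1 \<sigma> f) t = (\<sigma> \<circ> simplex_path f) t"
  using simplex_path_point_in_standard_simplex[OF assms] by (simp add: simplex_path_def simplex_map_def)

text \<open>A coefficient of the image chain is the sum of the coefficients over a fibre of
  \<open>simplex_map\<close>; injectivity reduces each fibre to one simplex.\<close>

lemma lookup_chain_map_inj:
  assumes "inj_on (simplex_map p \<sigma>) (Poly_Mapping.keys c)" "f \<in> Poly_Mapping.keys c"
  shows "Poly_Mapping.lookup (chain_map p \<sigma> c) (simplex_map p \<sigma> f) = Poly_Mapping.lookup c f"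
proof -
  have "Poly_Mapping.lookup (chain_map p \<sigma> c) (simplex_map p \<sigma> f) =
      (\<Sum>h\<in>Poly_Mapping.keys c. Poly_Mapping.lookup c h *
        Poly_Mapping.lookup (frag_of (simplex_map p \<sigma> h)) (simplex_map p \<sigma> f))"
    by (simp add: chain_map_def frag_extend_def lookup_sum)
  also have "\<dots> = (\<Sum>h\<in>Poly_Mapping.keys c. if h = f then Poly_Mapping.lookup c h else 0)"
    by (intro sum.cong refl) (use assms in \<open>auto simp: lookup_single when_def inj_on_def\<close>)
  also have "\<dots> = Poly_Mapping.lookup c f"
    using assms(2) by simp
  finally show ?thesis .
qed

lemma keys_chain_map_inj:
  assumes "inj_on (simplex_map p \<sigma>) (Poly_Mapping.keys c)"
  shows "Poly_Mapping.keys (chain_map p \<sigma> c) = simplex_map p \<sigma> ` Poly_Mapping.keys c"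
proof
  show "Poly_Mapping.keys (chain_map p \<sigma> c) \<subseteq> simplex_map p \<sigma> ` Poly_Mapping.keys c"
    using keys_frag_extend[of "frag_of \<circ> simplex_map p \<sigma>" c] by (auto simp: chain_map_def)
  show "simplex_map p \<sigma> ` Poly_Mapping.keys c \<subseteq> Poly_Mapping.keys (chain_map p \<sigma> c)"
    using lookup_chain_map_inj[OF assms] by (auto simp: in_keys_iff)
qed

section \<open>Homology classes and the cycles representing them\<close>

lemma homology_class_chain:
  assumes "x \<in> carrier (homology_group 1 X)"
  obtains c where "c \<in> x"
proof -
  obtain c where "x = homologous_rel_set 1 X {} c"
    using assms carrier_relative_homology_group[of 1 X "{}"] by auto
  then show ?thesis
    using that[of c] by simp
qed

lemma homology_class_member:
  assumes "x \<in> carrier (homology_group 1 X)" "c \<in> x"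
  shows "singular_relcycle 1 X {} c" "x = homologous_rel_set 1 X {} c" "singular_chain 1 X c"
proof -
  obtain d where d: "singular_relcycle 1 X {} d" "x = homologous_rel_set 1 X {} d"
    using assms(1) carrier_relative_homology_group[of 1 X "{}"] by auto
  then have dc: "homologous_rel 1 X {} d c"
    using assms(2) by simp
  show "singular_relcycle 1 X {} c"
    by (rule homologous_rel_singular_relcycle_1[OF dc d(1)])
  show "x = homologous_rel_set 1 X {} c"
    using d(2) dc by (simp only: homologous_rel_set_eq)
  show "singular_chain 1 X c"
    using \<open>singular_relcycle 1 X {} c\<close> by (simp add: singular_relcycle_def)
qed

text \<open>The relation makes \<open>y\<close> the inverse of the induced class, and the inverse of
  a coset in the homology group consists of the negatives of its elements.\<close>

lemma uminus_chain_map_in_class: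
  assumes x: "x \<in> carrier (homology_group 1 X)" and y: "y \<in> carrier (homology_group 1 X)"
    and \<sigma>: "continuous_map X X \<sigma>"
    and xy: "hom_induced 1 X {} X {} \<sigma> x \<otimes>\<^bsub>homology_group 1 X\<^esub> y = \<one>\<^bsub>homology_group 1 X\<^esub>"
    and c: "c \<in> x"
  shows "- chain_map 1 \<sigma> c \<in> y"
proof -
  let ?H = "homology_group 1 X"
  interpret H: comm_group ?H
    by simp
  have \<sigma>x: "hom_induced 1 X {} X {} \<sigma> x = homologous_rel_set 1 X {} (chain_map 1 \<sigma> c)"
    using hom_induced_chain_map[OF \<sigma> _ homology_class_member(1)[OF x c]]
    by (simp add: homology_class_member(2)[OF x c])
  have carrier: "hom_induced 1 X {} X {} \<sigma> x \<in> carrier ?H"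
    by (rule hom_induced_carrier)
  have "y = inv\<^bsub>?H\<^esub> (hom_induced 1 X {} X {} \<sigma> x)"
    using H.inv_equality[OF _ carrier y] xy H.m_comm[OF carrier y] by simp
  also have "\<dots> = uminus ` hom_induced 1 X {} X {} \<sigma> x"
    using inv_relative_homology_group[of _ 1] carrier by simp
  finally show ?thesis
    by (simp add: \<sigma>x)
qed

text \<open>Apply the induced homomorphism to the relation; its square is the identity. This
  supplies the relation for the cycle with index 4, which \<open>sigma_adapted\<close> states only
  for index 1.\<close>

lemma hom_induced_involution_swap:
  assumes x: "x \<in> carrier (homology_group 1 X)" and y: "y \<in> carrier (homology_group 1 X)"
    and \<sigma>: "continuous_map X X \<sigma>" "\<And>p. p \<in> topspace X \<Longrightarrow> \<sigma> (\<sigma> p) = p"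
    and xy: "hom_induced 1 X {} X {} \<sigma> x \<otimes>\<^bsub>homology_group 1 X\<^esub> y = \<one>\<^bsub>homology_group 1 X\<^esub>"
  shows "hom_induced 1 X {} X {} \<sigma> y \<otimes>\<^bsub>homology_group 1 X\<^esub> x = \<one>\<^bsub>homology_group 1 X\<^esub>"
proof -
  let ?H = "homology_group 1 X" and ?s = "hom_induced 1 X {} X {} \<sigma>"
  interpret H: comm_group ?H
    by simp
  have carrier: "?s z \<in> carrier ?H" for z
    by (rule hom_induced_carrier)
  have hom: "?s \<in> hom ?H ?H"
    by (rule hom_induced_hom)
  have "?s (?s x) = hom_induced 1 X {} X {} (\<sigma> \<circ> \<sigma>) x"
    using \<sigma>(1) by (simp add: hom_induced_compose')
  also have "\<dots> = x"
    using \<sigma> x by (intro hom_induced_id_gen continuous_map_compose) auto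
  finally have "x \<otimes>\<^bsub>?H\<^esub> ?s y = ?s (?s x) \<otimes>\<^bsub>?H\<^esub> ?s y"
    by simp
  also have "\<dots> = ?s (?s x \<otimes>\<^bsub>?H\<^esub> y)"
    using hom_mult[OF hom carrier y] by simp
  also have "\<dots> = \<one>\<^bsub>?H\<^esub>"
    unfolding xy by (rule hom_one[OF hom]) auto
  finally show ?thesis
    using H.m_comm[OF x carrier] by simp
qed

section \<open>Integrals over chains and periods over homology classes\<close>

context charted_surface
begin

lemma has_chain_integral_unique:
  assumes \<eta>: "holomorphic_differential \<A> \<eta>" and c: "singular_chain 1 X c"
    and I: "has_chain_integral \<A> \<eta> c I" and J: "has_chain_integral \<A> \<eta> c J"
  shows "I = J"
proof -
  obtain i j where i: "\<forall>f\<in>Poly_Mapping.keys c. has_path_integral \<A> \<eta> (simplex_path f) (i f)"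
    "I = (\<Sum>f\<in>Poly_Mapping.keys c. of_int (Poly_Mapping.lookup c f) * i f)"
    and j: "\<forall>f\<in>Poly_Mapping.keys c. has_path_integral \<A> \<eta> (simplex_path f) (j f)"
    "J = (\<Sum>f\<in>Poly_Mapping.keys c. of_int (Poly_Mapping.lookup c f) * j f)"
    using I J unfolding has_chain_integral_def by blast
  have "i f = j f" if f: "f \<in> Poly_Mapping.keys c" for f
  proof -
    have "singular_simplex 1 X f"
      using c f unfolding singular_chain_def by auto
    then show ?thesis
      using has_path_integral_unique[OF \<eta> pathin_simplex_path] i(1) j(1) f by blast
  qed
  then show ?thesis
    by (simp add: i(2) j(2))
qed

lemma has_chain_integral_sum:
  assumes \<eta>: "\<And>k. k \<in> K \<Longrightarrow> holomorphic_differential \<A> (\<eta> k)" and c: "singular_chain 1 X c"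
    and I: "\<And>k. k \<in> K \<Longrightarrow> has_chain_integral \<A> (\<eta> k) c (I k)"
  shows "has_chain_integral \<A> (\<lambda>ch z. \<Sum>k\<in>K. C k * \<eta> k ch z) c (\<Sum>k\<in>K. C k * I k)"
proof -
  have "\<forall>k\<in>K. \<exists>J. (\<forall>f\<in>Poly_Mapping.keys c. has_path_integral \<A> (\<eta> k) (simplex_path f) (J f)) \<and>
      I k = (\<Sum>f\<in>Poly_Mapping.keys c. of_int (Poly_Mapping.lookup c f) * J f)"
    using I unfolding has_chain_integral_def by blast
  then obtain J where J: "\<And>k f. k \<in> K \<Longrightarrow> f \<in> Poly_Mapping.keys c \<Longrightarrow>
      has_path_integral \<A> (\<eta> k) (simplex_path f) (J k f)"
    "\<And>k. k \<in> K \<Longrightarrow> I k = (\<Sum>f\<in>Poly_Mapping.keys c. of_int (Poly_Mapping.lookup c f) * J k f)"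
    by metis
  show ?thesis
    unfolding has_chain_integral_def
  proof (intro exI[of _ "\<lambda>f. \<Sum>k\<in>K. C k * J k f"] conjI ballI)
    fix f
    assume f: "f \<in> Poly_Mapping.keys c"
    then have "singular_simplex 1 X f"
      using c unfolding singular_chain_def by auto
    then show "has_path_integral \<A> (\<lambda>ch z. \<Sum>k\<in>K. C k * \<eta> k ch z) (simplex_path f) (\<Sum>k\<in>K. C k * J k f)"
      using \<eta> J(1) f by (intro has_path_integral_sum pathin_simplex_path)
  next
    have "(\<Sum>k\<in>K. C k * I k) =
        (\<Sum>k\<in>K. \<Sum>f\<in>Poly_Mapping.keys c. C k * (of_int (Poly_Mapping.lookup c f) * J k f))"
      by (simp add: J(2) sum_distrib_left)
    also have "\<dots> = (\<Sum>f\<in>Poly_Mapping.keys c. \<Sum>k\<in>K. C k * (of_int (Poly_Mapping.lookup c f) * J k f))"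
      by (rule sum.swap)
    also have "\<dots> = (\<Sum>f\<in>Poly_Mapping.keys c. of_int (Poly_Mapping.lookup c f) * (\<Sum>k\<in>K. C k * J k f))"
      by (simp add: sum_distrib_left mult.left_commute)
    finally show "(\<Sum>k\<in>K. C k * I k) =
        (\<Sum>f\<in>Poly_Mapping.keys c. of_int (Poly_Mapping.lookup c f) * (\<Sum>k\<in>K. C k * J k f))" .
  qed
qed

lemma has_chain_integral_pullback:
  assumes \<sigma>: "holomorphic_self_map X \<A> \<sigma>" "\<And>p. p \<in> topspace X \<Longrightarrow> \<sigma> (\<sigma> p) = p"
    and \<eta>: "holomorphic_differential \<A> \<eta>" and c: "singular_chain 1 X c"
    and I: "has_chain_integral \<A> \<eta> (chain_map 1 \<sigma> c) I"
  shows "has_chain_integral \<A> (pullback \<A> \<sigma> \<eta>) c I"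
proof -
  have simplex: "singular_simplex 1 X f" if "f \<in> Poly_Mapping.keys c" for f
    using c that unfolding singular_chain_def by auto
  have "simplex_map 1 \<sigma> (simplex_map 1 \<sigma> f) = f" if "f \<in> Poly_Mapping.keys c" for f
    using simplex_map_id_gen[OF simplex[OF that], of "\<sigma> \<circ> \<sigma>"] \<sigma>(2) by (simp add: simplex_map_compose)
  \<comment> \<open>Hence no simplices of \<open>c\<close> merge or cancel in the image chain, and an integral of \<open>\<eta>\<close> over the
    latter determines integrals over all \<open>\<sigma> \<circ> f\<close>.\<close>
  then have inj: "inj_on (simplex_map 1 \<sigma>) (Poly_Mapping.keys c)"
    by (metis inj_onI)
  obtain J where J: "\<forall>f\<in>Poly_Mapping.keys (chain_map 1 \<sigma> c). has_path_integral \<A> \<eta> (simplex_path f) (J f)"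
    and I: "I = (\<Sum>f\<in>Poly_Mapping.keys (chain_map 1 \<sigma> c). of_int (Poly_Mapping.lookup (chain_map 1 \<sigma> c) f) * J f)"
    using I unfolding has_chain_integral_def by blast
  show ?thesis
    unfolding has_chain_integral_def
  proof (intro exI[of _ "J \<circ> simplex_map 1 \<sigma>"] conjI ballI)
    fix f
    assume f: "f \<in> Poly_Mapping.keys c"
    then have "has_path_integral \<A> \<eta> (simplex_path (simplex_map 1 \<sigma> f)) (J (simplex_map 1 \<sigma> f))"
      using J keys_chain_map_inj[OF inj] by blast
    then have "has_path_integral \<A> \<eta> (\<sigma> \<circ> simplex_path f) (J (simplex_map 1 \<sigma> f))"
      by (rule has_path_integral_cong) (rule simplex_path_simplex_map)
    then show "has_path_integral \<A> (pullback \<A> \<sigma> \<eta>) (simplex_path f) ((J \<circ> simplex_map 1 \<sigma>) f)"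
      using has_path_integral_pullback[OF \<sigma>(1) \<eta> pathin_simplex_path[OF simplex[OF f]]] by simp
  next
    show "I = (\<Sum>f\<in>Poly_Mapping.keys c. of_int (Poly_Mapping.lookup c f) * (J \<circ> simplex_map 1 \<sigma>) f)"
      unfolding I keys_chain_map_inj[OF inj] sum.reindex[OF inj]
      by (intro sum.cong refl) (simp only: lookup_chain_map_inj[OF inj] comp_apply)
  qed
qed

text \<open>\<open>has_period\<close> quantifies over all cycles of a class, so uniqueness needs an
  actual representative; membership in the carrier provides it.\<close>

lemma has_period_unique:
  assumes x: "x \<in> carrier (homology_group 1 X)" and \<eta>: "holomorphic_differential \<A> \<eta>"
    and I: "has_period \<A> \<eta> x I" and J: "has_period \<A> \<eta> x J"
  shows "I = J"
proof -
  obtain c where c: "c \<in> x"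
    using homology_class_chain[OF x] .
  show ?thesis
    using I J c has_chain_integral_unique[OF \<eta> homology_class_member(3)[OF x c]]
    unfolding has_period_def by blast
qed

lemma has_period_sum:
  assumes x: "x \<in> carrier (homology_group 1 X)"
    and "\<And>k. k \<in> K \<Longrightarrow> holomorphic_differential \<A> (\<eta> k)"
    and "\<And>k. k \<in> K \<Longrightarrow> has_period \<A> (\<eta> k) x (I k)"
  shows "has_period \<A> (\<lambda>ch z. \<Sum>k\<in>K. C k * \<eta> k ch z) x (\<Sum>k\<in>K. C k * I k)"
  unfolding has_period_def
proof
  fix c
  assume "c \<in> x"
  then show "has_chain_integral \<A> (\<lambda>ch z. \<Sum>k\<in>K. C k * \<eta> k ch z) c (\<Sum>k\<in>K. C k * I k)"
    using assms(2,3) homology_class_member(3)[OF x] unfolding has_period_def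
    by (intro has_chain_integral_sum) auto
qed

text \<open>Integrating the pullback over \<open>c\<close> amounts to integrating \<eta> over the
  image of \<open>c\<close>, and the negative of that image represents \<open>y\<close>. Hence the
  sign.\<close>

lemma has_period_pullback:
  assumes \<sigma>: "holomorphic_self_map X \<A> \<sigma>" "\<And>p. p \<in> topspace X \<Longrightarrow> \<sigma> (\<sigma> p) = p"
    and \<eta>: "holomorphic_differential \<A> \<eta>"
    and x: "x \<in> carrier (homology_group 1 X)" and y: "y \<in> carrier (homology_group 1 X)"
    and xy: "hom_induced 1 X {} X {} \<sigma> x \<otimes>\<^bsub>homology_group 1 X\<^esub> y = \<one>\<^bsub>homology_group 1 X\<^esub>"
    and I: "has_period \<A> \<eta> y I"
  shows "has_period \<A> (pullback \<A> \<sigma> \<eta>) x (- I)"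
  unfolding has_period_def
proof
  fix c
  assume c: "c \<in> x"
  have "continuous_map X X \<sigma>"
    using \<sigma>(1) by (simp add: holomorphic_self_map_def)
  then have "- chain_map 1 \<sigma> c \<in> y"
    by (rule uminus_chain_map_in_class[OF x y _ xy c])
  \<comment> \<open>The double negation returns from the representative of \<open>y\<close> to the
    image chain itself.\<close>
  then have "has_chain_integral \<A> \<eta> (- (- chain_map 1 \<sigma> c)) (- I)"
    using I unfolding has_period_def by (blast intro: has_chain_integral_uminus)
  then show "has_chain_integral \<A> (pullback \<A> \<sigma> \<eta>) c (- I)"
    using homology_class_member(3)[OF x c] by (intro has_chain_integral_pullback[OF \<sigma> \<eta>]) simp_all
qed

text \<open>Each period of the pullback is computed twice, from the homology relation and from the
  expansion in the normalized basis. The minus sign enters once through the \<open>a\<close>-cycles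
  and once through the \<open>b\<close>-cycles, and cancels.\<close>

lemma period_matrix_involution:
  fixes a b :: "'n::finite \<Rightarrow> 'p chain set"
  assumes \<sigma>: "holomorphic_self_map X \<A> \<sigma>" "\<And>p. p \<in> topspace X \<Longrightarrow> \<sigma> (\<sigma> p) = p"
    and carrier: "\<And>j. a j \<in> carrier (homology_group 1 X)" "\<And>j. b j \<in> carrier (homology_group 1 X)"
    and a: "\<And>j. hom_induced 1 X {} X {} \<sigma> (a j) \<otimes>\<^bsub>homology_group 1 X\<^esub> a (s j) = \<one>\<^bsub>homology_group 1 X\<^esub>"
    and b: "\<And>j. hom_induced 1 X {} X {} \<sigma> (b j) \<otimes>\<^bsub>homology_group 1 X\<^esub> b (s j) = \<one>\<^bsub>homology_group 1 X\<^esub>"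
    and s: "\<And>j. s (s j) = j"
    and \<eta>: "normalized_differentials \<A> a \<eta>" and \<Omega>: "period_matrix \<A> b \<eta> \<Omega>"
  shows "\<Omega> $ s j $ k = \<Omega> $ j $ s k"
proof -
  have hol: "holomorphic_differential \<A> (\<eta> l)" for l
    using \<eta> by (simp add: normalized_differentials_def)
  have per_a: "has_period \<A> (\<eta> l) (a i) (if i = l then 1 else 0)" for i l
    using \<eta> by (simp add: normalized_differentials_def)
  have per_b: "has_period \<A> (\<eta> l) (b i) (\<Omega> $ i $ l)" for i l
    using \<Omega> by (simp add: period_matrix_def)
  obtain C :: "complex^'n" where
    C: "same_differential \<A> (pullback \<A> \<sigma> (\<eta> k)) (\<lambda>ch z. \<Sum>l\<in>UNIV. C$l * \<eta> l ch z)"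
    using \<eta> holomorphic_differential_pullback[OF \<sigma>(1) hol] unfolding normalized_differentials_def by blast
  let ?\<zeta> = "\<lambda>ch z. \<Sum>l\<in>UNIV. C$l * \<eta> l ch z"
  have hol\<zeta>: "holomorphic_differential \<A> ?\<zeta>"
    by (rule holomorphic_differential_sum) (rule hol)
  have same: "has_period \<A> ?\<zeta> x I" if "has_period \<A> (pullback \<A> \<sigma> (\<eta> k)) x I" for x I
    using that has_chain_integral_same_differential[OF C] unfolding has_period_def by blast
  \<comment> \<open>Normalization makes the \<open>i\<close>-th coefficient equal to the
    \<open>i\<close>-th \<open>a\<close>-period, so the pullback of differential \<open>k\<close> is
    minus the differential \<open>s k\<close>.\<close>
  have coeff: "C $ i = - (if s i = k then 1 else 0)" for i
  proof -
    have "has_period \<A> ?\<zeta> (a i) (- (if s i = k then 1 else 0))"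
      by (intro same has_period_pullback[OF \<sigma> hol carrier(1) carrier(1) a] per_a)
    moreover have "has_period \<A> ?\<zeta> (a i) (\<Sum>l\<in>UNIV. C$l * (if i = l then 1 else 0))"
      by (intro has_period_sum carrier hol per_a)
    ultimately have "- (if s i = k then 1 else 0) = (\<Sum>l\<in>UNIV. C$l * (if i = l then 1 else 0))"
      by (rule has_period_unique[OF carrier(1) hol\<zeta>])
    also have "\<dots> = (\<Sum>l\<in>UNIV. if l = i then C$l else 0)"
      by (intro sum.cong) auto
    finally show ?thesis
      by simp
  qed
  have "has_period \<A> ?\<zeta> (b j) (- \<Omega> $ s j $ k)"
    by (intro same has_period_pullback[OF \<sigma> hol carrier(2) carrier(2) b] per_b)
  moreover have "has_period \<A> ?\<zeta> (b j) (\<Sum>l\<in>UNIV. C$l * \<Omega>$j$l)"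
    by (intro has_period_sum carrier hol per_b)
  ultimately have "- \<Omega> $ s j $ k = (\<Sum>l\<in>UNIV. C$l * \<Omega>$j$l)"
    by (rule has_period_unique[OF carrier(2) hol\<zeta>])
  also have "\<dots> = (\<Sum>l\<in>UNIV. if l = s k then - \<Omega>$j$l else 0)"
  proof (intro sum.cong refl)
    fix l
    have "s l = k \<longleftrightarrow> l = s k"
      using s by metis
    then show "C$l * \<Omega>$j$l = (if l = s k then - \<Omega>$j$l else 0)"
      by (simp add: coeff)
  qed
  finally show ?thesis
    by simp
qed

end

section \<open>The period matrix of the spectral curve\<close>

text \<open>Brings the adapted relations into the uniform shape with one index involution that the
  comparison of periods expects.\<close>

lemma sigma_adapted_swap:
  fixes j :: 4
  assumes "\<And>j. a j \<in> carrier (homology_group 1 X)"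
    and \<sigma>: "continuous_map X X \<sigma>" "\<And>p. p \<in> topspace X \<Longrightarrow> \<sigma> (\<sigma> p) = p"
    and a: "sigma_adapted X \<sigma> a"
  shows "hom_induced 1 X {} X {} \<sigma> (a j) \<otimes>\<^bsub>homology_group 1 X\<^esub> a (Transposition.transpose 1 4 j) = \<one>\<^bsub>homology_group 1 X\<^esub>"
proof -
  let ?H = "homology_group 1 X" and ?s = "hom_induced 1 X {} X {} \<sigma>"
  have a1: "?s (a 1) \<otimes>\<^bsub>?H\<^esub> a 4 = \<one>\<^bsub>?H\<^esub>" and a2: "?s (a 2) \<otimes>\<^bsub>?H\<^esub> a 2 = \<one>\<^bsub>?H\<^esub>"
    and a3: "?s (a 3) \<otimes>\<^bsub>?H\<^esub> a 3 = \<one>\<^bsub>?H\<^esub>"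
    using a unfolding sigma_adapted_def Let_def by blast+
  have a4: "?s (a 4) \<otimes>\<^bsub>?H\<^esub> a 1 = \<one>\<^bsub>?H\<^esub>"
    by (rule hom_induced_involution_swap[OF assms(1) assms(1) \<sigma> a1])
  consider "j = 1" | "j = 2" | "j = 3" | "j = 4"
    using exhaust_4 by blast
  then show ?thesis
  proof cases
    case 1
    then show ?thesis
      using a1 by (simp only: transpose_apply_first)
  next
    case 2
    moreover have "Transposition.transpose 1 4 2 = (2::4)"
      by (rule transpose_apply_other) simp_all
    ultimately show ?thesis
      using a2 by (simp only:)
  next
    case 3
    moreover have "Transposition.transpose 1 4 3 = (3::4)"
      by (rule transpose_apply_other) simp_all
    ultimately show ?thesis
      using a3 by (simp only:)
  next
    case 4
    then show ?thesis
      using a4 by (simp only: transpose_apply_second)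
  qed
qed

context charted_surface
begin

text \<open>Written as linear combinations, the Prym differentials fall under the general results on
  sums, and their periods become combinations of entries of \<Omega>.\<close>

lemma prym_differential_eq_sum:
  "prym_differential \<eta> k = (\<lambda>c z. \<Sum>l\<in>UNIV. (if k = 1 then if l = 1 \<or> l = 4 then 1 else 0
      else if k = 2 then if l = 2 then 1 else 0 else if l = 3 then 1 else 0) * \<eta> l c z)"
  unfolding sum_4 prym_differential_def by (cases "k = 1"; cases "k = 2") simp_all

lemma has_period_prym_differential:
  assumes b: "\<And>j. b j \<in> carrier (homology_group 1 X)"
    and \<eta>: "\<And>k. holomorphic_differential \<A> (\<eta> k)" and \<Omega>: "period_matrix \<A> b \<eta> \<Omega>"
    and I: "has_period \<A> (prym_differential \<eta> k) (b j) I"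
  shows "I = (if k = 1 then \<Omega>$j$1 + \<Omega>$j$4 else if k = 2 then \<Omega>$j$2 else \<Omega>$j$3)"
proof -
  let ?C = "\<lambda>l. if k = 1 then if l = 1 \<or> l = 4 then 1 else 0
      else if k = 2 then if l = 2 then 1 else 0 else if l = 3 then 1 else 0"
  have "has_period \<A> (prym_differential \<eta> k) (b j) (\<Sum>l\<in>UNIV. ?C l * \<Omega>$j$l)"
    unfolding prym_differential_eq_sum using \<Omega>
    by (intro has_period_sum b \<eta>) (simp add: period_matrix_def)
  moreover have "holomorphic_differential \<A> (prym_differential \<eta> k)"
    unfolding prym_differential_eq_sum by (intro holomorphic_differential_sum \<eta>)
  ultimately have "I = (\<Sum>l\<in>UNIV. ?C l * \<Omega>$j$l)"
    using has_period_unique[OF b _ I] by blast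
  then show ?thesis
    by (simp add: sum_4)
qed

lemma prym_reduction_periods:
  assumes \<sigma>: "holomorphic_self_map X \<A> \<sigma>" "\<And>p. p \<in> topspace X \<Longrightarrow> \<sigma> (\<sigma> p) = p"
    and cycles: "canonical_basis X \<A> a b" "sigma_adapted X \<sigma> a" "sigma_adapted X \<sigma> b"
    and \<eta>: "normalized_differentials \<A> a \<eta>"
    and \<Omega>: "period_matrix \<A> b \<eta> \<Omega>" "transpose \<Omega> = \<Omega>"
    and P: "prym_period_matrix \<A> b \<eta> P"
  shows "prym_reduction \<Omega> P"
proof -
  have a: "a j \<in> carrier (homology_group 1 X)" and b: "b j \<in> carrier (homology_group 1 X)" for j
    using cycles(1) by (simp_all add: canonical_basis_def Let_def)
  have cont: "continuous_map X X \<sigma>"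
    using \<sigma>(1) by (simp add: holomorphic_self_map_def)
  let ?s = "Transposition.transpose 1 4 :: 4 \<Rightarrow> 4"
  have swap: "\<Omega> $ ?s j $ k = \<Omega> $ j $ ?s k" for j k
    by (rule period_matrix_involution[OF \<sigma> a b sigma_adapted_swap[OF a cont \<sigma>(2) cycles(2)]
        sigma_adapted_swap[OF b cont \<sigma>(2) cycles(3)] _ \<eta> \<Omega>(1)]) simp_all
  have "\<Omega>$1$1 = \<Omega>$4$4" "\<Omega>$4$2 = \<Omega>$1$2" "\<Omega>$4$3 = \<Omega>$1$3"
    using swap[of 1 4] swap[of 1 2] swap[of 1 3] by (simp_all add: Transposition.transpose_def)
  moreover have "P = vector [vector [2 * (\<Omega>$1$1 + \<Omega>$1$4), 2 * \<Omega>$1$2, 2 * \<Omega>$1$3],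
      vector [\<Omega>$2$1 + \<Omega>$2$4, \<Omega>$2$2, \<Omega>$2$3], vector [\<Omega>$3$1 + \<Omega>$3$4, \<Omega>$3$2, \<Omega>$3$3]]"
  proof -
    have hol: "holomorphic_differential \<A> (\<eta> k)" for k
      using \<eta> by (simp add: normalized_differentials_def)
    have "P$1$k = 2 * (if k = 1 then \<Omega>$1$1 + \<Omega>$1$4 else if k = 2 then \<Omega>$1$2 else \<Omega>$1$3)" for k
    proof -
      obtain I where I: "has_period \<A> (prym_differential \<eta> k) (b 1) I" "P$1$k = 2 * I"
        using P unfolding prym_period_matrix_def by blast
      show ?thesis
        unfolding I(2) using has_period_prym_differential[OF b hol \<Omega>(1) I(1)] by simp
    qed
    moreover have "P$2$k = (if k = 1 then \<Omega>$2$1 + \<Omega>$2$4 else if k = 2 then \<Omega>$2$2 else \<Omega>$2$3)" for k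
      by (rule has_period_prym_differential[OF b hol \<Omega>(1)]) (use P in \<open>simp add: prym_period_matrix_def\<close>)
    moreover have "P$3$k = (if k = 1 then \<Omega>$3$1 + \<Omega>$3$4 else if k = 2 then \<Omega>$3$2 else \<Omega>$3$3)" for k
      by (rule has_period_prym_differential[OF b hol \<Omega>(1)]) (use P in \<open>simp add: prym_period_matrix_def\<close>)
    ultimately show ?thesis
      by (simp add: vec_eq_iff forall_3)
  qed
  ultimately show ?thesis
    using \<Omega>(2) by (simp add: prym_reduction_def)
qed

end

theorem theorem5:
  fixes S :: "(real^3) set" and \<rho> :: "real^3 \<Rightarrow> real" and \<phi> :: "real^3 \<Rightarrow> real"
    and \<omega> M \<alpha> \<beta> \<gamma> :: "real \<Rightarrow> real^3"
    and B :: "real^3^3" and u :: "real \<Rightarrow> real^3^3"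
    and X :: "'p topology" and \<A> :: "'p chart set" and w E :: "'p \<Rightarrow> complex"
    and Pinf :: "'p set" and \<sigma> :: "'p \<Rightarrow> 'p" and Y :: "'p set topology"
    and a b :: "4 \<Rightarrow> 'p chain set" and \<eta> :: "4 \<Rightarrow> 'p differential"
    and \<Omega> :: "complex^4^4" and P :: "complex^3^3"
    and A \<xi> :: "3 \<Rightarrow> 3 \<Rightarrow> complex" and z :: "3 \<Rightarrow> 3 \<Rightarrow> complex^4"
    and z0 U :: "complex^4" and U1 U2 U3 :: complex
  assumes body: "rigid_body S \<rho>"
    and potential: "homogeneous_quadratic \<phi>"
    and motion: "euler_motion S \<rho> \<phi> \<omega> M \<alpha> \<beta> \<gamma>"
    and symmetric: "transpose B = B" "\<And>t. transpose (u t) = u t"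
    and lax: "lax_equation (\<lambda>t. lax_L B (skew (M t)) (u t))
                           (\<lambda>t. lax_Q (skew (\<omega> t)) (inertia_tensor S \<rho>))"
    and curve: "\<And>t. smooth_completion (spectral_poly (lax_L B (skew (M t)) (u t))) X \<A> w E Pinf"
    and involution: "spectral_involution X \<A> w E Pinf \<sigma>"
    and genus: "has_genus X 4"
    and elliptic: "orbit_quotient X \<sigma> Y" "has_genus Y 1"
    and fixed_points: "card {p \<in> topspace X. \<sigma> p = p} = 6"
    and cycles: "canonical_basis X \<A> a b" "sigma_adapted X \<sigma> a" "sigma_adapted X \<sigma> b"
    and differentials: "normalized_differentials \<A> a \<eta>"
    and Omega: "period_matrix \<A> b \<eta> \<Omega>" "siegel_upper_half \<Omega>"
    and Pi: "prym_period_matrix \<A> b \<eta> P"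
    and U: "U = vector [U1, U2, U3, U1]" "tangent_to_prym \<Omega> U"
    and solution: "\<And>i j t. of_real (skew (\<omega> t) $ i $ j) =
           A i j * exp (of_real t * \<xi> i j) *
           (theta (of_real t *s U + z i j) \<Omega> / theta (of_real t *s U + z0) \<Omega>)"
  shows "\<forall>i j t. of_real (skew (\<omega> t) $ i $ j) =
           A i j * exp (of_real t * \<xi> i j) *
           ((c_coeff \<Omega> P 0 (- z i j) * theta (of_real t *s vector [2 * U1, U2, U3] + tilde (z i j)) P
             + c_coeff \<Omega> P 1 (- z i j) *
               theta_char (matrix_inv Delta *v eps 1) 0 (of_real t *s vector [2 * U1, U2, U3] + tilde (z i j)) P)
            / (c_coeff \<Omega> P 0 (- z0) * theta (of_real t *s vector [2 * U1, U2, U3] + tilde z0) P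
               + c_coeff \<Omega> P 1 (- z0) *
                 theta_char (matrix_inv Delta *v eps 1) 0 (of_real t *s vector [2 * U1, U2, U3] + tilde z0) P))"
proof -
  \<comment> \<open>The completed curve is the same surface at all times, so any instant gives its
    complex structure.\<close>
  have "riemann_surface X \<A>"
    using curve[of 0] by (simp add: smooth_completion_def compact_riemann_surface_def)
  then interpret charted_surface X \<A>
    by unfold_locales
  have \<sigma>: "holomorphic_self_map X \<A> \<sigma>" "\<And>p. p \<in> topspace X \<Longrightarrow> \<sigma> (\<sigma> p) = p"
    using involution by (simp_all add: spectral_involution_def)
  have "transpose \<Omega> = \<Omega>"
    using Omega(2) by (simp add: siegel_upper_half_def)
  then have reduction: "prym_reduction \<Omega> P"
    using prym_reduction_periods[OF \<sigma>] cycles differentials Omega(1) Pi by blast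
  \<comment> \<open>Numerator and denominator are the same line restriction, based at
    \<open>z i j\<close> and at \<open>z0\<close>.\<close>
  show ?thesis
    using solution unfolding U(1) theta_prym_line[OF Omega(2) reduction] by blast
qed

end
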